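(* Let $\mathcal H$ be an irreducible complete Nevanlinna–Pick space on a nonempty set $X$ with reproducing kernel $K$, and suppose that for every multiplier $\varphi$ of $\mathcal H$ the multiplication operator $M_\varphi \in \mathcal B(\mathcal H)$ is hyponormal. Then exactly one of the following holds: (1) $X$ is a singleton and $\mathcal H = \mathbb C$; (2) there exist a set of uniqueness $A \subset \mathbb D$ for $H^2$, a bijection $j : X \to A$ and a nowhere vanishing function $\delta : X \to \mathbb C$ such that $$K(\lambda,\mu) = \delta(\lambda)\overline{\delta(\mu)}\, k(j(\lambda),j(\mu)) \quad (\lambda,\mu\in X),$$ where $k(z,w) = (1-z\overline w)^{-1}$ is the Szegő kernel. Consequently the map $H^2 \to \mathcal H$, $f \mapsto \delta\,(f\circ j)$, is unitary. Moreover, if $X$ carries a topology for which $K$ is separately continuous on $X\times X$, then $j$ is continuous; and if $X\subset \mathbb C^n$ and $K$ is holomorphic in the first variable, then $j$ is holomorphic.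
   Context: A reproducing kernel Hilbert space $\mathcal H$ on a set $X$ with kernel $K$ is called irreducible if $K(x,y)\neq 0$ for all $x,y\in X$ and $K(\cdot,x)$, $K(\cdot,y)$ are linearly independent whenever $x\neq y$. A multiplier of $\mathcal H$ is a function $\varphi:X\to\mathbb C$ with $\varphi f\in\mathcal H$ for all $f\in\mathcal H$; $M_\varphi$ denotes the (bounded) operator $f\mapsto \varphi f$. $\mathcal H$ is a complete Nevanlinna–Pick space if for all $n,m\ge 1$, all $z_1,\dots,z_n\in X$ and all $m\times m$ matrices $W_1,\dots,W_n$, positivity of the block matrix $\big((I - W_iW_j^* )K(z_i,z_j)\big)_{i,j=1}^n$ implies the existence of an $m\times m$-matrix-valued multiplier $\Phi$ of $\mathcal H\otimes\mathbb C^m$ with multiplier norm at most $1$ and $\Phi(z_i)=W_i$ for all $i$. An operator $T$ is hyponormal if $T^*T - TT^*\ge 0$, i.e. $\|T^*f\|\le\|Tf\|$ for all $f$. $H^2$ is the Hardy space on the open unit disk $\mathbb D$ (the RKHS with the Szegő kernel). A set $A\subset\mathbb D$ is a set of uniqueness for $H^2$ if the only $f\in H^2$ vanishing on $A$ is $f=0$. *)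

theory Defs
  imports "HOL-Analysis.Analysis"
begin

text \<open>A Hilbert space of functions on the type 'x (the set X) is given by its carrier
  Hs (a set of functions 'x => complex, with pointwise operations) and its inner product
  ip, linear in the first argument.\<close>

definition hnorm :: "(('x \<Rightarrow> complex) \<Rightarrow> ('x \<Rightarrow> complex) \<Rightarrow> complex) \<Rightarrow> ('x \<Rightarrow> complex) \<Rightarrow> real" where
  "hnorm ip f = sqrt (Re (ip f f))"

definition is_rkhs ::
  "('x \<Rightarrow> complex) set \<Rightarrow> (('x \<Rightarrow> complex) \<Rightarrow> ('x \<Rightarrow> complex) \<Rightarrow> complex)
     \<Rightarrow> ('x \<Rightarrow> 'x \<Rightarrow> complex) \<Rightarrow> bool" where
  "is_rkhs Hs ip K \<longleftrightarrow>
     (\<lambda>x. 0) \<in> Hs \<and>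
     (\<forall>f\<in>Hs. \<forall>g\<in>Hs. (\<lambda>x. f x + g x) \<in> Hs) \<and>
     (\<forall>c. \<forall>f\<in>Hs. (\<lambda>x. c * f x) \<in> Hs) \<and>
     (\<forall>f\<in>Hs. \<forall>g\<in>Hs. \<forall>h\<in>Hs. ip (\<lambda>x. f x + g x) h = ip f h + ip g h) \<and>
     (\<forall>c. \<forall>f\<in>Hs. \<forall>g\<in>Hs. ip (\<lambda>x. c * f x) g = c * ip f g) \<and>
     (\<forall>f\<in>Hs. \<forall>g\<in>Hs. ip g f = cnj (ip f g)) \<and>
     (\<forall>f\<in>Hs. Re (ip f f) \<ge> 0) \<and>
     (\<forall>f\<in>Hs. ip f f = 0 \<longrightarrow> f = (\<lambda>x. 0)) \<and>
     (\<forall>s::nat \<Rightarrow> 'x \<Rightarrow> complex. (\<forall>n. s n \<in> Hs) \<longrightarrow>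
          (\<forall>e::real>0. \<exists>N. \<forall>p\<ge>N. \<forall>q\<ge>N. hnorm ip (\<lambda>x. s p x - s q x) < e) \<longrightarrow>
          (\<exists>f\<in>Hs. \<forall>e::real>0. \<exists>N. \<forall>p\<ge>N. hnorm ip (\<lambda>x. s p x - f x) < e)) \<and>
     (\<forall>y. (\<lambda>x. K x y) \<in> Hs) \<and>
     (\<forall>f\<in>Hs. \<forall>y. f y = ip f (\<lambda>x. K x y))"

definition irreducible_kernel :: "('x \<Rightarrow> 'x \<Rightarrow> complex) \<Rightarrow> bool" where
  "irreducible_kernel K \<longleftrightarrow>
     (\<forall>x y. K x y \<noteq> 0) \<and>
     (\<forall>x y. x \<noteq> y \<longrightarrow> (\<forall>a b. (\<lambda>z. a * K z x + b * K z y) = (\<lambda>z. 0) \<longrightarrow> a = 0 \<and> b = 0))"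

definition multiplier :: "('x \<Rightarrow> complex) set \<Rightarrow> ('x \<Rightarrow> complex) \<Rightarrow> bool" where
  "multiplier Hs \<phi> \<longleftrightarrow> (\<forall>f\<in>Hs. (\<lambda>x. \<phi> x * f x) \<in> Hs)"

definition hyponormal ::
  "('x \<Rightarrow> complex) set \<Rightarrow> (('x \<Rightarrow> complex) \<Rightarrow> ('x \<Rightarrow> complex) \<Rightarrow> complex)
     \<Rightarrow> (('x \<Rightarrow> complex) \<Rightarrow> ('x \<Rightarrow> complex)) \<Rightarrow> bool" where
  "hyponormal Hs ip T \<longleftrightarrow>
     (\<exists>S. (\<forall>g\<in>Hs. S g \<in> Hs) \<and>
          (\<forall>f\<in>Hs. \<forall>g\<in>Hs. ip (T f) g = ip f (S g)) \<and>
          (\<forall>f\<in>Hs. hnorm ip (S f) \<le> hnorm ip (T f)))"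

text \<open>Complete Nevanlinna-Pick property. Points z_0..z_(n-1), m x m matrices W i (entries
  W i k l, k,l < m). Matrix-valued functions Phi x k l. H tensor C^m is realised as
  m-tuples of elements of H with the sum-of-squares norm.\<close>
definition complete_NP ::
  "('x \<Rightarrow> complex) set \<Rightarrow> (('x \<Rightarrow> complex) \<Rightarrow> ('x \<Rightarrow> complex) \<Rightarrow> complex)
     \<Rightarrow> ('x \<Rightarrow> 'x \<Rightarrow> complex) \<Rightarrow> bool" where
  "complete_NP Hs ip K \<longleftrightarrow>
    (\<forall>(n::nat) (m::nat) (z::nat \<Rightarrow> 'x) (W::nat \<Rightarrow> nat \<Rightarrow> nat \<Rightarrow> complex).
       n \<ge> 1 \<longrightarrow> m \<ge> 1 \<longrightarrow>
       (\<forall>v::nat \<Rightarrow> nat \<Rightarrow> complex.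
          let q = (\<Sum>i<n. \<Sum>k<m. \<Sum>j<n. \<Sum>l<m.
                    cnj (v i k) * (((if k = l then 1 else 0) - (\<Sum>p<m. W i k p * cnj (W j l p)))
                       * K (z i) (z j)) * v j l)
          in Im q = 0 \<and> Re q \<ge> 0) \<longrightarrow>
       (\<exists>\<Phi>::'x \<Rightarrow> nat \<Rightarrow> nat \<Rightarrow> complex.
          (\<forall>F::nat \<Rightarrow> 'x \<Rightarrow> complex. (\<forall>l<m. F l \<in> Hs) \<longrightarrow>
              (\<forall>k<m. (\<lambda>x. \<Sum>l<m. \<Phi> x k l * F l x) \<in> Hs) \<and>
              (\<Sum>k<m. (hnorm ip (\<lambda>x. \<Sum>l<m. \<Phi> x k l * F l x))\<^sup>2) \<le> (\<Sum>l<m. (hnorm ip (F l))\<^sup>2)) \<and>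
          (\<forall>i<n. \<forall>k<m. \<forall>l<m. \<Phi> (z i) k l = W i k l)))"

definition H2_coeffs :: "(complex \<Rightarrow> complex) \<Rightarrow> (nat \<Rightarrow> complex) \<Rightarrow> bool" where
  "H2_coeffs f a \<longleftrightarrow> summable (\<lambda>n. (cmod (a n))\<^sup>2) \<and>
      (\<forall>z\<in>ball 0 1. (\<lambda>n. a n * z ^ n) sums f z)"

definition H2 :: "(complex \<Rightarrow> complex) set" where
  "H2 = {f. \<exists>a. H2_coeffs f a}"

definition szego :: "complex \<Rightarrow> complex \<Rightarrow> complex" where
  "szego z w = 1 / (1 - z * cnj w)"

definition uniqueness_set_H2 :: "complex set \<Rightarrow> bool" where
  "uniqueness_set_H2 A \<longleftrightarrow> A \<subseteq> ball 0 1 \<and>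
     (\<forall>f\<in>H2. (\<forall>z\<in>A. f z = 0) \<longrightarrow> (\<forall>z\<in>ball 0 1. f z = 0))"

definition holo_open :: "(complex ^ 'n \<Rightarrow> complex) \<Rightarrow> (complex ^ 'n) set \<Rightarrow> bool" where
  "holo_open f U \<longleftrightarrow> open U \<and>
     (\<forall>z\<in>U. \<exists>D. (f has_derivative D) (at z) \<and> (\<forall>c v. D (c *s v) = c * D v))"

definition holo_on_set :: "(complex ^ 'n \<Rightarrow> complex) \<Rightarrow> (complex ^ 'n) set \<Rightarrow> bool" where
  "holo_on_set f S \<longleftrightarrow>
     (\<forall>z\<in>S. \<exists>U g. z \<in> U \<and> holo_open g U \<and> (\<forall>w\<in>U \<inter> S. g w = f w))"

end

theory Submission
  imports Defs
begin

text \<open>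
  Fix a point \<open>x\<^sub>0\<close> and let \<open>e\<close> be the normalised kernel function at \<open>x\<^sub>0\<close>, which plays the role of
  the constant function \<open>1\<close>; put \<open>L(x,y) = 1 - e(x) cnj(e(y)) / K(x,y)\<close>. If a contractive multiplier
  \<open>\<phi>\<close> vanishes at \<open>x\<^sub>0\<close> and is extremal at \<open>y\<close>, that is \<open>\<bar>\<phi>(y)\<bar>\<^sup>2 = L(y,y)\<close>, then
  \<open>\<phi>(x) cnj(\<phi>(y)) = L(x,y)\<close> for all \<open>x\<close>, and hyponormality makes \<open>M\<^sub>\<phi>\<close> isometric on the span of
  the \<open>\<phi>\<^sup>n e\<close>, which are orthonormal. If such a \<open>\<phi>\<close> were not extremal at a further point
  \<open>w\<close>, the complete Pick property on \<open>{x\<^sub>0, y, w}\<close> would give a row contraction \<open>(p, q)\<close> all of whose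
  unit combinations \<open>a p + b q\<close> are isometric at the powers of themselves. The norms of the
  \<open>p\<^sup>i q\<^sup>j e\<close> are then those of monomials in the Drury--Arveson space of the two-ball, where
  multiplication by \<open>z\<^sub>1 z\<^sub>2\<close> is not hyponormal. Hence \<open>L(x,y) = \<phi>(x) cnj(\<phi>(y))\<close> everywhere,
  which is the claimed form of \<open>K\<close> with \<open>j = \<phi>\<close> and \<open>\<delta> = e\<close>.
\<close>

section \<open>Reproducing kernel Hilbert spaces\<close>

locale rkhs =
  fixes Hs :: "('x \<Rightarrow> complex) set"
    and ip :: "('x \<Rightarrow> complex) \<Rightarrow> ('x \<Rightarrow> complex) \<Rightarrow> complex"
    and K :: "'x \<Rightarrow> 'x \<Rightarrow> complex"
  assumes rkhs: "is_rkhs Hs ip K"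
begin

definition sq :: "('x \<Rightarrow> complex) \<Rightarrow> real" where
  "sq f = Re (ip f f)"

lemma zero_mem: "(\<lambda>x. 0) \<in> Hs"
  and add_mem: "f \<in> Hs \<Longrightarrow> g \<in> Hs \<Longrightarrow> (\<lambda>x. f x + g x) \<in> Hs"
  and scale_mem: "f \<in> Hs \<Longrightarrow> (\<lambda>x. c * f x) \<in> Hs"
  and kernel_mem: "(\<lambda>x. K x y) \<in> Hs"
proof -
  note r = rkhs[unfolded is_rkhs_def]
  show "(\<lambda>x. 0) \<in> Hs" using r by (elim conjE)
  have "\<forall>f\<in>Hs. \<forall>g\<in>Hs. (\<lambda>x. f x + g x) \<in> Hs" using r by (elim conjE)
  then show "f \<in> Hs \<Longrightarrow> g \<in> Hs \<Longrightarrow> (\<lambda>x. f x + g x) \<in> Hs" by simp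
  have "\<forall>c. \<forall>f\<in>Hs. (\<lambda>x. c * f x) \<in> Hs" using r by (elim conjE)
  then show "f \<in> Hs \<Longrightarrow> (\<lambda>x. c * f x) \<in> Hs" by simp
  have "\<forall>y. (\<lambda>x. K x y) \<in> Hs" using r by (elim conjE)
  then show "(\<lambda>x. K x y) \<in> Hs" by simp
qed

lemma ip_add_left:
    "f \<in> Hs \<Longrightarrow> g \<in> Hs \<Longrightarrow> h \<in> Hs \<Longrightarrow> ip (\<lambda>x. f x + g x) h = ip f h + ip g h"
  and ip_scale_left: "f \<in> Hs \<Longrightarrow> g \<in> Hs \<Longrightarrow> ip (\<lambda>x. c * f x) g = c * ip f g"
  and ip_commute: "f \<in> Hs \<Longrightarrow> g \<in> Hs \<Longrightarrow> ip g f = cnj (ip f g)"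
  and sq_nonneg: "f \<in> Hs \<Longrightarrow> 0 \<le> sq f"
  and ip_self_eq_0: "f \<in> Hs \<Longrightarrow> ip f f = 0 \<Longrightarrow> f = (\<lambda>x. 0)"
proof -
  note r = rkhs[unfolded is_rkhs_def]
  have "\<forall>f\<in>Hs. \<forall>g\<in>Hs. \<forall>h\<in>Hs. ip (\<lambda>x. f x + g x) h = ip f h + ip g h"
    using r by (elim conjE)
  then show "f \<in> Hs \<Longrightarrow> g \<in> Hs \<Longrightarrow> h \<in> Hs \<Longrightarrow> ip (\<lambda>x. f x + g x) h = ip f h + ip g h"
    by simp
  have "\<forall>c. \<forall>f\<in>Hs. \<forall>g\<in>Hs. ip (\<lambda>x. c * f x) g = c * ip f g" using r by (elim conjE)
  then show "f \<in> Hs \<Longrightarrow> g \<in> Hs \<Longrightarrow> ip (\<lambda>x. c * f x) g = c * ip f g" by simp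
  have "\<forall>f\<in>Hs. \<forall>g\<in>Hs. ip g f = cnj (ip f g)" using r by (elim conjE)
  then show "f \<in> Hs \<Longrightarrow> g \<in> Hs \<Longrightarrow> ip g f = cnj (ip f g)" by blast
  have "\<forall>f\<in>Hs. Re (ip f f) \<ge> 0" using r by (elim conjE)
  then show "f \<in> Hs \<Longrightarrow> 0 \<le> sq f" by (simp add: sq_def)
  have "\<forall>f\<in>Hs. ip f f = 0 \<longrightarrow> f = (\<lambda>x. 0)" using r by (elim conjE)
  then show "f \<in> Hs \<Longrightarrow> ip f f = 0 \<Longrightarrow> f = (\<lambda>x. 0)" by blast
qed

lemma ip_kernel:
  assumes "f \<in> Hs"
  shows "ip f (\<lambda>x. K x y) = f y"
proof -
  have "\<forall>f\<in>Hs. \<forall>y. f y = ip f (\<lambda>x. K x y)"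
    using rkhs unfolding is_rkhs_def by (elim conjE)
  then show ?thesis using assms by metis
qed

lemma complete:
  fixes s :: "nat \<Rightarrow> 'x \<Rightarrow> complex"
  assumes "\<And>n. s n \<in> Hs"
    and "\<And>e::real. e > 0 \<Longrightarrow> \<exists>N. \<forall>p\<ge>N. \<forall>q\<ge>N. hnorm ip (\<lambda>x. s p x - s q x) < e"
  shows "\<exists>f\<in>Hs. \<forall>e::real>0. \<exists>N. \<forall>p\<ge>N. hnorm ip (\<lambda>x. s p x - f x) < e"
proof -
  have "\<forall>s::nat \<Rightarrow> 'x \<Rightarrow> complex. (\<forall>n. s n \<in> Hs) \<longrightarrow>
      (\<forall>e::real>0. \<exists>N. \<forall>p\<ge>N. \<forall>q\<ge>N. hnorm ip (\<lambda>x. s p x - s q x) < e) \<longrightarrow>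
      (\<exists>f\<in>Hs. \<forall>e::real>0. \<exists>N. \<forall>p\<ge>N. hnorm ip (\<lambda>x. s p x - f x) < e)"
    using rkhs unfolding is_rkhs_def by (elim conjE)
  from this[rule_format, of s, OF assms] show ?thesis .
qed

lemma hnorm_eq: "hnorm ip f = sqrt (sq f)"
  by (simp add: hnorm_def sq_def)

lemma hnorm_power2: "f \<in> Hs \<Longrightarrow> (hnorm ip f)\<^sup>2 = sq f"
  by (simp add: hnorm_eq sq_nonneg)

lemma diff_mem: "f \<in> Hs \<Longrightarrow> g \<in> Hs \<Longrightarrow> (\<lambda>x. f x - g x) \<in> Hs"
  using add_mem[of f "\<lambda>x. (-1) * g x"] scale_mem[of g "-1"] by simp

lemma ip_diff_left:
  "f \<in> Hs \<Longrightarrow> g \<in> Hs \<Longrightarrow> h \<in> Hs \<Longrightarrow> ip (\<lambda>x. f x - g x) h = ip f h - ip g h"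
  using ip_add_left[of f "\<lambda>x. (-1) * g x" h] scale_mem[of g "-1"] ip_scale_left[of g h "-1"]
  by simp

lemma ip_add_right:
  "f \<in> Hs \<Longrightarrow> g \<in> Hs \<Longrightarrow> h \<in> Hs \<Longrightarrow> ip h (\<lambda>x. f x + g x) = ip h f + ip h g"
  using ip_commute[of "\<lambda>x. f x + g x" h] ip_commute[of f h] ip_commute[of g h]
  by (simp add: add_mem ip_add_left)

lemma ip_diff_right:
  "f \<in> Hs \<Longrightarrow> g \<in> Hs \<Longrightarrow> h \<in> Hs \<Longrightarrow> ip h (\<lambda>x. f x - g x) = ip h f - ip h g"
  using ip_commute[of "\<lambda>x. f x - g x" h] ip_commute[of f h] ip_commute[of g h]
  by (simp add: diff_mem ip_diff_left)

lemma ip_scale_right: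
  "f \<in> Hs \<Longrightarrow> g \<in> Hs \<Longrightarrow> ip g (\<lambda>x. c * f x) = cnj c * ip g f"
  using ip_commute[of "\<lambda>x. c * f x" g] ip_commute[of f g]
  by (simp add: scale_mem ip_scale_left)

lemma ip_self:
  assumes "f \<in> Hs"
  shows "ip f f = of_real (sq f)"
proof -
  have "Im (ip f f) = Im (cnj (ip f f))" using ip_commute assms by metis
  then show ?thesis by (simp add: sq_def complex_eq_iff)
qed

lemma sq_eq_0: "f \<in> Hs \<Longrightarrow> sq f = 0 \<Longrightarrow> f = (\<lambda>x. 0)"
  using ip_self_eq_0 ip_self by simp

lemma sq_scale: "f \<in> Hs \<Longrightarrow> sq (\<lambda>x. c * f x) = (cmod c)\<^sup>2 * sq f"
  by (simp add: sq_def[of "\<lambda>x. c * f x"] ip_scale_left ip_scale_right scale_mem ip_self cmod_power2)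
     (simp add: power2_eq_square algebra_simps)

lemma sq_add:
  "f \<in> Hs \<Longrightarrow> g \<in> Hs \<Longrightarrow> sq (\<lambda>x. f x + g x) = sq f + sq g + 2 * Re (ip f g)"
  using ip_commute[of f g] by (simp add: sq_def ip_add_left ip_add_right add_mem)

lemma sq_diff:
  "f \<in> Hs \<Longrightarrow> g \<in> Hs \<Longrightarrow> sq (\<lambda>x. f x - g x) = sq f + sq g - 2 * Re (ip f g)"
  using ip_commute[of f g] by (simp add: sq_def ip_diff_left ip_diff_right diff_mem)

lemma parallelogram:
  assumes "f \<in> Hs" "g \<in> Hs"
  shows "sq (\<lambda>x. f x + g x) + sq (\<lambda>x. f x - g x) = 2 * sq f + 2 * sq g"
  using assms by (simp add: sq_add sq_diff)

lemma ip_ext: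
  assumes "g \<in> Hs" "h \<in> Hs" "\<And>f. f \<in> Hs \<Longrightarrow> ip f g = ip f h"
  shows "g = h"
proof -
  have d: "(\<lambda>x. g x - h x) \<in> Hs" using assms diff_mem by blast
  have "ip (\<lambda>x. g x - h x) (\<lambda>x. g x - h x) = 0"
    using assms(3)[OF d] d assms by (simp add: ip_diff_right)
  then show ?thesis using ip_self_eq_0[OF d] by (metis eq_iff_diff_eq_0 ext)
qed

lemma sum_mem:
  "finite I \<Longrightarrow> (\<And>i. i \<in> I \<Longrightarrow> F i \<in> Hs) \<Longrightarrow> (\<lambda>x. \<Sum>i\<in>I. c i * F i x) \<in> Hs"
proof (induction I rule: finite_induct)
  case empty
  show ?case by (simp add: zero_mem)
next
  case (insert i I)
  then show ?case using add_mem[of "\<lambda>x. c i * F i x" "\<lambda>x. \<Sum>i\<in>I. c i * F i x"]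
    by (simp add: scale_mem)
qed

lemma ip_sum_left:
  "finite I \<Longrightarrow> (\<And>i. i \<in> I \<Longrightarrow> F i \<in> Hs) \<Longrightarrow> g \<in> Hs \<Longrightarrow>
    ip (\<lambda>x. \<Sum>i\<in>I. c i * F i x) g = (\<Sum>i\<in>I. c i * ip (F i) g)"
proof (induction I rule: finite_induct)
  case empty
  show ?case using ip_scale_left[OF zero_mem empty(2), of 0] by simp
next
  case (insert i I)
  then show ?case
    using ip_add_left[of "\<lambda>x. c i * F i x" "\<lambda>x. \<Sum>i\<in>I. c i * F i x" g]
    by (simp add: scale_mem sum_mem ip_scale_left)
qed

lemma ip_sum_right:
  "finite I \<Longrightarrow> (\<And>i. i \<in> I \<Longrightarrow> F i \<in> Hs) \<Longrightarrow> g \<in> Hs \<Longrightarrow>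
    ip g (\<lambda>x. \<Sum>i\<in>I. c i * F i x) = (\<Sum>i\<in>I. cnj (c i) * ip g (F i))"
  using ip_commute[of "\<lambda>x. \<Sum>i\<in>I. c i * F i x" g] ip_commute[of "F _" g]
  by (simp add: sum_mem ip_sum_left)

lemma Cauchy_Schwarz:
  assumes f: "f \<in> Hs" and g: "g \<in> Hs"
  shows "(cmod (ip f g))\<^sup>2 \<le> sq f * sq g"
proof (cases "sq g = 0")
  case True
  then have "g = (\<lambda>x. 0 * f x)" using sq_eq_0 g by simp
  then have "ip f g = 0" using ip_scale_right[OF f f, of 0] by simp
  then show ?thesis by (simp add: True)
next
  case False
  then have pos: "sq g > 0" using sq_nonneg[OF g] by simp
  \<comment> \<open>The vector \<open>c * g\<close> is the orthogonal projection of \<open>f\<close>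
    onto the line through \<open>g\<close>.\<close>
  define c where "c = ip f g / sq g"
  have c: "Re (ip f (\<lambda>x. c * g x)) = (cmod (ip f g))\<^sup>2 / sq g"
    by (simp only: ip_scale_right f g c_def)
      (simp add: complex_mult_cnj cmod_power2 mult.commute flip: power2_eq_square)
  have "0 \<le> sq (\<lambda>x. f x - c * g x)" using f g by (simp add: diff_mem scale_mem sq_nonneg)
  also have "\<dots> = sq f - (cmod (ip f g))\<^sup>2 / sq g"
    using pos by (simp add: sq_diff f g scale_mem sq_scale c)
      (simp add: c_def norm_divide power_divide power2_eq_square)
  finally show ?thesis using pos by (simp add: field_simps)
qed

section \<open>Orthonormal systems: finite sums, Bessel's inequality and the Riesz-Fischer
  theorem\<close>

lemma ip_orthonormal_sum:
  assumes "\<And>n. u n \<in> Hs" "\<And>m n. ip (u m) (u n) = (if m = n then 1 else 0)" and "finite I"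
  shows "ip (\<lambda>x. \<Sum>k\<in>I. c k * u k x) (u m) = (if m \<in> I then c m else 0)"
  using assms by (simp add: ip_sum_left if_distrib[of "\<lambda>t. _ * t"] cong: if_cong)

lemma sq_orthonormal_sum:
  assumes u: "\<And>n. u n \<in> Hs" "\<And>m n. ip (u m) (u n) = (if m = n then 1 else 0)" and I: "finite I"
  shows "sq (\<lambda>x. \<Sum>k\<in>I. c k * u k x) = (\<Sum>k\<in>I. (cmod (c k))\<^sup>2)"
proof -
  define d where "d = (\<lambda>x. \<Sum>k\<in>I. c k * u k x)"
  have dm: "d \<in> Hs" unfolding d_def using u I by (intro sum_mem)
  have "ip d d = (\<Sum>k\<in>I. cnj (c k) * ip d (u k))"
    by (subst (2) d_def, subst ip_sum_right) (use u I dm in auto)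
  also have "\<dots> = of_real (\<Sum>k\<in>I. (cmod (c k))\<^sup>2)"
    unfolding of_real_sum by (rule sum.cong)
      (simp_all only: d_def ip_orthonormal_sum[OF u I] if_True complex_norm_square mult.commute)
  finally show ?thesis by (simp only: d_def sq_def Re_complex_of_real)
qed

lemma Bessel:
  assumes u: "\<And>n. u n \<in> Hs" "\<And>m n. ip (u m) (u n) = (if m = n then 1 else 0)" and g: "g \<in> Hs"
  shows "(\<Sum>k<(n::nat). (cmod (ip g (u k)))\<^sup>2) \<le> sq g"
proof -
  \<comment> \<open>The projection of \<open>g\<close> onto the span of the first \<open>n\<close>
    vectors; both \<open>ip g p\<close> and \<open>sq p\<close> equal the partial sum in
    question.\<close>
  define p where "p = (\<lambda>x. \<Sum>k<n. ip g (u k) * u k x)"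
  have p: "p \<in> Hs" unfolding p_def by (rule sum_mem) (use u in auto)
  have gp: "ip g p = of_real (\<Sum>k<n. (cmod (ip g (u k)))\<^sup>2)"
    unfolding p_def of_real_sum complex_norm_square
    by (subst ip_sum_right) (use u g in \<open>simp_all add: mult.commute\<close>)
  have pp: "sq p = (\<Sum>k<n. (cmod (ip g (u k)))\<^sup>2)"
    unfolding p_def using u by (intro sq_orthonormal_sum) simp_all
  have "0 \<le> sq (\<lambda>x. g x - p x)" using g p diff_mem sq_nonneg by blast
  also have "\<dots> = sq g - sq p" using gp pp by (simp add: sq_diff g p del: of_real_sum)
  finally show ?thesis using pp by simp
qed

text \<open>Riesz-Fischer: the partial sums are Cauchy, and Cauchy-Schwarz turns their norm
  convergence into convergence of inner products. Testing against \<open>u n\<close> then yields the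
  coefficients, and testing against the limit itself yields its norm.\<close>

lemma orthonormal_series:
  assumes u: "\<And>n. u n \<in> Hs" "\<And>m n. ip (u m) (u n) = (if m = n then 1 else 0)"
    and a: "summable (\<lambda>n::nat. (cmod (a n))\<^sup>2)"
  obtains h where "h \<in> Hs" "\<And>g. g \<in> Hs \<Longrightarrow> (\<lambda>k. a k * ip (u k) g) sums ip h g"
    "\<And>n. ip h (u n) = a n" "sq h = (\<Sum>n. (cmod (a n))\<^sup>2)"
proof -
  define s where "s n = (\<lambda>x. \<Sum>k<n. a k * u k x)" for n
  have s: "s n \<in> Hs" for n unfolding s_def by (rule sum_mem) (use u in auto)
  have su: "ip (s n) g = (\<Sum>k<n. a k * ip (u k) g)" if "g \<in> Hs" for n g
    unfolding s_def by (subst ip_sum_left) (use u that in auto)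
  have sqd: "sq (\<lambda>x. s p x - s q x) = (\<Sum>k\<in>{q..<p}. (cmod (a k))\<^sup>2)" if "q \<le> p" for p q
  proof -
    define d where "d = (\<lambda>x. s p x - s q x)"
    have d: "d = (\<lambda>x. \<Sum>k\<in>{q..<p}. a k * u k x)"
      unfolding d_def s_def using that
      by (simp add: sum_diff_nat_ivl[where m=0, simplified atLeast0LessThan])
    show ?thesis unfolding d_def[symmetric] unfolding d using u by (intro sq_orthonormal_sum) simp_all
  qed
  have cauchy: "\<exists>N. \<forall>p\<ge>N. \<forall>q\<ge>N. hnorm ip (\<lambda>x. s p x - s q x) < e" if "e > 0" for e :: real
  proof -
    have "\<exists>N. \<forall>m\<ge>N. \<forall>n. norm (\<Sum>k\<in>{m..<n}. (cmod (a k))\<^sup>2) < e\<^sup>2"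
      using a that unfolding summable_Cauchy by (meson zero_less_power)
    then obtain N where N: "\<And>m n. m \<ge> N \<Longrightarrow> (\<Sum>k\<in>{m..<n}. (cmod (a k))\<^sup>2) < e\<^sup>2"
      by (auto simp: abs_less_iff)
    have *: "hnorm ip (\<lambda>x. s p x - s q x) < e" if "q \<le> p" "q \<ge> N" for p q
      using N[of q p] that \<open>e > 0\<close> by (simp add: hnorm_eq sqd real_less_lsqrt)
    have sym: "hnorm ip (\<lambda>x. s p x - s q x) = hnorm ip (\<lambda>x. s q x - s p x)" for p q
      using sq_scale[OF diff_mem[OF s s], of "-1" p q] by (simp add: hnorm_eq)
    show ?thesis using * sym by (metis nle_le)
  qed
  obtain h where h: "h \<in> Hs" and lim: "\<forall>e>0. \<exists>N. \<forall>p\<ge>N. hnorm ip (\<lambda>x. s p x - h x) < e"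
    using complete[OF s cauchy] by blast
  have weak: "(\<lambda>k. a k * ip (u k) g) sums ip h g" if g: "g \<in> Hs" for g
  proof -
    have "(\<lambda>n. hnorm ip (\<lambda>x. s n x - h x)) \<longlonglongrightarrow> 0"
      unfolding LIMSEQ_def dist_real_def using lim by (simp add: hnorm_eq sq_nonneg diff_mem s h)
    then have lim0: "(\<lambda>n. hnorm ip (\<lambda>x. s n x - h x) * hnorm ip g) \<longlonglongrightarrow> 0"
      by (rule tendsto_mult_left_zero)
    have "cmod (ip (s n) g - ip h g) \<le> hnorm ip (\<lambda>x. s n x - h x) * hnorm ip g" for n
    proof -
      have "(cmod (ip (\<lambda>x. s n x - h x) g))\<^sup>2 \<le> sq (\<lambda>x. s n x - h x) * sq g"
        by (rule Cauchy_Schwarz) (use diff_mem s h g in auto)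
      then have "cmod (ip (\<lambda>x. s n x - h x) g) \<le> sqrt (sq (\<lambda>x. s n x - h x) * sq g)"
        by (rule real_le_rsqrt)
      then show ?thesis by (simp add: hnorm_eq real_sqrt_mult ip_diff_left s h g)
    qed
    then have "(\<lambda>n. ip (s n) g - ip h g) \<longlonglongrightarrow> 0"
      by (intro Lim_null_comparison[OF _ lim0]) simp
    then show ?thesis unfolding sums_def su[OF g, symmetric] by (simp add: LIM_zero_iff)
  qed
  have hu: "ip h (u n) = a n" for n
  proof -
    have "(\<lambda>k. a k * ip (u k) (u n)) = (\<lambda>k. if k = n then a n else 0)" using u by auto
    then show ?thesis
      using weak[OF u(1)[of n]] sums_single[of n "\<lambda>_. a n"] sums_unique2 by metis
  qed
  have "(\<lambda>k. of_real ((cmod (a k))\<^sup>2)) sums ip h h"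
  proof -
    have "a k * ip (u k) h = of_real ((cmod (a k))\<^sup>2)" for k
      using ip_commute[OF h u(1)[of k]] by (simp only: hu complex_norm_square)
    then show ?thesis using weak[OF h] by (simp only:)
  qed
  then have "(\<lambda>k. (cmod (a k))\<^sup>2) sums sq h" unfolding sq_def by (drule_tac sums_Re) (simp only: Re_complex_of_real)
  then show thesis using that h weak hu by (simp add: sums_iff)
qed

end

section \<open>Contractive multipliers and rows\<close>

context rkhs
begin

definition contractive :: "('x \<Rightarrow> complex) \<Rightarrow> bool" where
  "contractive \<phi> \<longleftrightarrow> (\<forall>f\<in>Hs. (\<lambda>x. \<phi> x * f x) \<in> Hs \<and> sq (\<lambda>x. \<phi> x * f x) \<le> sq f)"

text \<open>A property of the single vector \<open>f\<close>, not of the whole operator. For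
  hyponormal multipliers the vectors with this property turn out to form a subspace invariant under
  \<open>\<phi>\<close>.\<close>

definition isometric :: "('x \<Rightarrow> complex) \<Rightarrow> ('x \<Rightarrow> complex) \<Rightarrow> bool" where
  "isometric \<phi> f \<longleftrightarrow> f \<in> Hs \<and> sq (\<lambda>x. \<phi> x * f x) = sq f"

text \<open>The row operator from the direct sum of two copies of the space to the space has norm at
  most 1.\<close>

definition row_contractive :: "('x \<Rightarrow> complex) \<Rightarrow> ('x \<Rightarrow> complex) \<Rightarrow> bool" where
  "row_contractive p q \<longleftrightarrow> (\<forall>f\<in>Hs. \<forall>g\<in>Hs. (\<lambda>x. p x * f x + q x * g x) \<in> Hs \<and>
     sq (\<lambda>x. p x * f x + q x * g x) \<le> sq f + sq g)"

lemma contractive_mem: "contractive \<phi> \<Longrightarrow> f \<in> Hs \<Longrightarrow> (\<lambda>x. \<phi> x * f x) \<in> Hs"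
  and contractive_sq_le: "contractive \<phi> \<Longrightarrow> f \<in> Hs \<Longrightarrow> sq (\<lambda>x. \<phi> x * f x) \<le> sq f"
  by (auto simp: contractive_def)

lemma contractive_multiplier: "contractive \<phi> \<Longrightarrow> multiplier Hs \<phi>"
  by (auto simp: contractive_def multiplier_def)

lemma contractive_power_mem:
  assumes "contractive \<phi>" "f \<in> Hs"
  shows "(\<lambda>x. \<phi> x ^ n * f x) \<in> Hs"
  by (induction n) (use assms contractive_mem in \<open>simp_all add: mult.assoc\<close>)

lemma sq_zero: "sq (\<lambda>x. 0) = 0"
  using sq_scale[OF zero_mem, of 0] by simp

text \<open>The combination is the row composed with the isometric column sending \<open>f\<close>
  to \<open>(a f, b f)\<close>.\<close>

lemma row_contractive_combine:
  assumes pq: "row_contractive p q" and ab: "(cmod a)\<^sup>2 + (cmod b)\<^sup>2 = 1"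
  shows "contractive (\<lambda>x. a * p x + b * q x)"
  unfolding contractive_def
proof (intro ballI)
  fix f assume f: "f \<in> Hs"
  have eq: "(\<lambda>x. (a * p x + b * q x) * f x) = (\<lambda>x. p x * (a * f x) + q x * (b * f x))"
    by (simp add: algebra_simps)
  have "sq (\<lambda>x. a * f x) + sq (\<lambda>x. b * f x) = sq f"
    using ab f by (simp add: sq_scale flip: distrib_right)
  then show "(\<lambda>x. (a * p x + b * q x) * f x) \<in> Hs \<and> sq (\<lambda>x. (a * p x + b * q x) * f x) \<le> sq f"
    unfolding eq using pq[unfolded row_contractive_def, rule_format, OF scale_mem[OF f] scale_mem[OF f]]
    by metis
qed

lemma row_contractive_left: "row_contractive p q \<Longrightarrow> contractive p"
  using row_contractive_combine[of p q 1 0] by simp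

lemma row_contractive_right: "row_contractive p q \<Longrightarrow> contractive q"
  using row_contractive_combine[of p q 0 1] by simp

text \<open>If the first entry already uses up the whole norm of \<open>f\<close>, adding a small
  multiple of \<open>g\<close> in the second entry may increase the squared norm of the output only
  to second order, so the first-order cross term vanishes.\<close>

lemma row_orthogonal:
  assumes pq: "row_contractive p q" and f: "isometric p f" and g: "g \<in> Hs"
  shows "ip (\<lambda>x. p x * f x) (\<lambda>x. q x * g x) = 0"
proof -
  define c where "c = ip (\<lambda>x. p x * f x) (\<lambda>x. q x * g x)"
  \<comment> \<open>The phase of \<open>c\<close> makes the cross term nonnegative. The denominator
    makes the second-order term at most half of it, and the summand 1 covers the case
    \<open>sq g = 0\<close>.\<close>
  define t where "t = c / of_real (sq g + 1)"
  have fH: "f \<in> Hs" and fs: "sq (\<lambda>x. p x * f x) = sq f" using f by (auto simp: isometric_def)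
  have pf: "(\<lambda>x. p x * f x) \<in> Hs" using contractive_mem[OF row_contractive_left[OF pq] fH] .
  have qg: "(\<lambda>x. q x * g x) \<in> Hs" using contractive_mem[OF row_contractive_right[OF pq] g] .
  have M: "sq g \<ge> 0" using g sq_nonneg by blast
  have eq: "(\<lambda>x. p x * f x + q x * (t * g x)) = (\<lambda>x. p x * f x + t * (q x * g x))"
    by (simp add: algebra_simps)
  have "cnj t * c = of_real ((cmod c)\<^sup>2 / (sq g + 1))"
    unfolding of_real_divide complex_norm_square by (simp add: t_def mult.commute)
  then have tc: "Re (cnj t * c) = (cmod c)\<^sup>2 / (sq g + 1)" by (metis Re_complex_of_real)
  have "sq (\<lambda>x. p x * f x + q x * (t * g x)) \<le> sq f + sq (\<lambda>x. t * g x)"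
    using pq[unfolded row_contractive_def, rule_format, OF fH scale_mem[OF g]] by blast
  then have "sq f + sq (\<lambda>x. t * (q x * g x)) + 2 * Re (cnj t * c) \<le> sq f + sq (\<lambda>x. t * g x)"
    unfolding eq sq_add[OF pf scale_mem[OF qg]] fs ip_scale_right[OF qg pf] c_def .
  then have "2 * ((cmod c)\<^sup>2 / (sq g + 1)) \<le> (cmod t)\<^sup>2 * sq g"
    using sq_nonneg[OF scale_mem[OF qg, of t]] tc by (simp add: sq_scale g)
  also have "\<dots> = (cmod c)\<^sup>2 / (sq g + 1) * (sq g / (sq g + 1))"
    using M by (simp add: t_def norm_divide power2_eq_square)
  also have "\<dots> \<le> (cmod c)\<^sup>2 / (sq g + 1) * 1"
    using M by (intro mult_left_mono) auto
  finally have "(cmod c)\<^sup>2 / (sq g + 1) \<le> 0" by simp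
  then have "c = 0" using M by (auto simp: field_simps)
  then show ?thesis by (simp add: c_def)
qed

text \<open>Padding the row \<open>(\<alpha>\<^sub>i, \<beta>\<^sub>i)\<close> with a zero second row makes it a matrix to which the
  complete Pick property applies.\<close>

lemma row_interpolation:
  fixes n :: nat and z :: "nat \<Rightarrow> 'x"
  assumes cnp: "complete_NP Hs ip K" and n: "n \<ge> 1"
    and pick: "\<And>i j. i < n \<Longrightarrow> j < n \<Longrightarrow>
      (1 - \<alpha> i * cnj (\<alpha> j) - \<beta> i * cnj (\<beta> j)) * K (z i) (z j) = e (z i) * cnj (e (z j))"
  obtains p q where "row_contractive p q" "\<And>i. i < n \<Longrightarrow> p (z i) = \<alpha> i" "\<And>i. i < n \<Longrightarrow> q (z i) = \<beta> i"
proof -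
  define W :: "nat \<Rightarrow> nat \<Rightarrow> nat \<Rightarrow> complex" where
    "W i k l = (if k = 0 then (if l = 0 then \<alpha> i else \<beta> i) else 0)" for i k l
  have two: "{..<2::nat} = {0, 1}" by auto
  have pos: "let q = (\<Sum>i<n. \<Sum>k<2. \<Sum>j<n. \<Sum>l<2.
                    cnj (v i k) * (((if k = l then 1 else 0) - (\<Sum>p<2. W i k p * cnj (W j l p)))
                       * K (z i) (z j)) * v j l)
          in Im q = 0 \<and> Re q \<ge> 0" for v :: "nat \<Rightarrow> nat \<Rightarrow> complex"
  proof -
    \<comment> \<open>The quadratic form splits into the squared modulus of \<open>s\<close>,
      because the Pick matrix of the first row has rank one, and the squared norm of
      \<open>F\<close>, which the zero row contributes.\<close>
    define F where "F = (\<lambda>x. \<Sum>i<n. v i 1 * K x (z i))"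
    define s where "s = (\<Sum>i<n. cnj (v i 0) * e (z i))"
    have F: "F \<in> Hs" unfolding F_def by (rule sum_mem) (use kernel_mem in auto)
    have FF: "ip F F = (\<Sum>i<n. \<Sum>j<n. cnj (v i 1) * K (z i) (z j) * v j 1)"
    proof -
      have "ip F F = (\<Sum>i<n. cnj (v i 1) * ip F (\<lambda>x. K x (z i)))"
        by (subst (2) F_def, subst ip_sum_right) (use F kernel_mem in auto)
      also have "\<dots> = (\<Sum>i<n. cnj (v i 1) * F (z i))" by (simp add: ip_kernel F)
      finally show ?thesis by (simp add: F_def sum_distrib_left mult_ac)
    qed
    have ss: "s * cnj s = (\<Sum>i<n. \<Sum>j<n. cnj (v i 0) * (e (z i) * cnj (e (z j))) * v j 0)"
      by (simp add: s_def sum_product mult_ac)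
    have "(\<Sum>i<n. \<Sum>k<2. \<Sum>j<n. \<Sum>l<2.
        cnj (v i k) * (((if k = l then 1 else 0) - (\<Sum>p<2. W i k p * cnj (W j l p)))
                       * K (z i) (z j)) * v j l)
      = (\<Sum>i<n. \<Sum>j<n. cnj (v i 0) * ((1 - \<alpha> i * cnj (\<alpha> j) - \<beta> i * cnj (\<beta> j)) * K (z i) (z j)) * v j 0)
      + (\<Sum>i<n. \<Sum>j<n. cnj (v i 1) * K (z i) (z j) * v j 1)"
      by (simp add: two W_def sum.distrib diff_diff_eq mult_ac)
    also have "\<dots> = s * cnj s + ip F F"
      unfolding ss FF using pick by simp
    finally show ?thesis
      using ip_self[OF F] sq_nonneg[OF F] by (simp add: complex_mult_cnj Let_def)
  qed
  obtain \<Phi> :: "'x \<Rightarrow> nat \<Rightarrow> nat \<Rightarrow> complex" where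
    \<Phi>: "\<And>F. (\<forall>l<2. F l \<in> Hs) \<Longrightarrow>
        (\<forall>k<2. (\<lambda>x. \<Sum>l<2. \<Phi> x k l * F l x) \<in> Hs) \<and>
        (\<Sum>k<2. (hnorm ip (\<lambda>x. \<Sum>l<2. \<Phi> x k l * F l x))\<^sup>2) \<le> (\<Sum>l<2. (hnorm ip (F l))\<^sup>2)"
    and val: "\<forall>i<n. \<forall>k<2. \<forall>l<2. \<Phi> (z i) k l = W i k l"
    using cnp[unfolded complete_NP_def, rule_format, of n 2 W z, OF n _ pos] by auto
  \<comment> \<open>Dropping the second component of the output can only decrease the norm.\<close>
  have "row_contractive (\<lambda>x. \<Phi> x 0 0) (\<lambda>x. \<Phi> x 0 1)"
    unfolding row_contractive_def
  proof (intro ballI)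
    fix f g assume f: "f \<in> Hs" and g: "g \<in> Hs"
    define F where "F l = (if l = 0 then f else g)" for l :: nat
    have "(\<lambda>x. \<Phi> x 0 0 * f x + \<Phi> x 0 1 * g x) \<in> Hs"
      "(\<lambda>x. \<Phi> x 1 0 * f x + \<Phi> x 1 1 * g x) \<in> Hs"
      "(hnorm ip (\<lambda>x. \<Phi> x 0 0 * f x + \<Phi> x 0 1 * g x))\<^sup>2
        + (hnorm ip (\<lambda>x. \<Phi> x 1 0 * f x + \<Phi> x 1 1 * g x))\<^sup>2 \<le> (hnorm ip f)\<^sup>2 + (hnorm ip g)\<^sup>2"
      using \<Phi>[of F] f g by (simp_all add: two F_def)
    then show "(\<lambda>x. \<Phi> x 0 0 * f x + \<Phi> x 0 1 * g x) \<in> Hs \<and>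
        sq (\<lambda>x. \<Phi> x 0 0 * f x + \<Phi> x 0 1 * g x) \<le> sq f + sq g"
      using f g sq_nonneg by (fastforce simp: hnorm_power2)
  qed
  moreover have "\<Phi> (z i) 0 0 = \<alpha> i" "\<Phi> (z i) 0 1 = \<beta> i" if "i < n" for i
    using val that by (auto simp: W_def)
  ultimately show thesis using that by blast
qed

end

section \<open>Hyponormal multiplication operators and the vectors at which they are
  isometric\<close>

locale hyponormal_rkhs = rkhs Hs ip K for Hs :: "('x \<Rightarrow> complex) set" and ip K +
  assumes hypo: "\<forall>\<phi>. multiplier Hs \<phi> \<longrightarrow> hyponormal Hs ip (\<lambda>f x. \<phi> x * f x)"
begin

definition hyponormal_adjoint where
  "hyponormal_adjoint \<phi> S \<longleftrightarrow> (\<forall>g\<in>Hs. S g \<in> Hs) \<and>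
     (\<forall>f\<in>Hs. \<forall>g\<in>Hs. ip (\<lambda>x. \<phi> x * f x) g = ip f (S g)) \<and>
     (\<forall>f\<in>Hs. sq (S f) \<le> sq (\<lambda>x. \<phi> x * f x))"

lemma adjoint_exists: "multiplier Hs \<phi> \<Longrightarrow> \<exists>S. hyponormal_adjoint \<phi> S"
  using hypo unfolding hyponormal_def hyponormal_adjoint_def hnorm_eq real_sqrt_le_iff by blast

lemma adjoint_mem: "hyponormal_adjoint \<phi> S \<Longrightarrow> g \<in> Hs \<Longrightarrow> S g \<in> Hs"
  and ip_adjoint: "hyponormal_adjoint \<phi> S \<Longrightarrow> f \<in> Hs \<Longrightarrow> g \<in> Hs \<Longrightarrow> ip (\<lambda>x. \<phi> x * f x) g = ip f (S g)"
  and sq_adjoint_le: "hyponormal_adjoint \<phi> S \<Longrightarrow> f \<in> Hs \<Longrightarrow> sq (S f) \<le> sq (\<lambda>x. \<phi> x * f x)"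
  by (simp_all add: hyponormal_adjoint_def)

text \<open>Hyponormality and contractivity bound the norm of \<open>S (\<phi> f)\<close> by that of
  \<open>f\<close>, while its inner product with \<open>f\<close> is the squared norm of
  \<open>f\<close>. Expanding the square shows that the two vectors coincide.\<close>

lemma isometric_adjoint:
  assumes \<phi>: "contractive \<phi>" and f: "isometric \<phi> f"
    and S: "hyponormal_adjoint \<phi> S"
  shows "S (\<lambda>x. \<phi> x * f x) = f"
proof -
  define h where "h = (\<lambda>x. \<phi> x * f x)"
  have fH: "f \<in> Hs" and fs: "sq h = sq f" using f by (auto simp: isometric_def h_def)
  have h: "h \<in> Hs" unfolding h_def using \<phi> fH contractive_mem by blast
  have "sq (S h) \<le> sq f" using sq_adjoint_le[OF S h] contractive_sq_le[OF \<phi> h] fs by simp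
  moreover have "Re (ip f (S h)) = sq f" using ip_adjoint[OF S fH h] fs by (simp add: sq_def h_def)
  ultimately have "sq (\<lambda>x. f x - S h x) \<le> 0" by (simp add: sq_diff fH adjoint_mem[OF S] h)
  then have "sq (\<lambda>x. f x - S h x) = 0" using sq_nonneg[OF diff_mem[OF fH adjoint_mem[OF S h]]] by simp
  then have "(\<lambda>x. f x - S h x) = (\<lambda>x. 0)" using sq_eq_0 diff_mem fH adjoint_mem[OF S] h by blast
  then show ?thesis unfolding h_def by (metis eq_iff_diff_eq_0 ext)
qed

text \<open>Moving \<open>\<phi>\<close> across the inner product and applying
  \<open>S (\<phi> f) = f\<close> gives the identity for arbitrary \<open>g\<close>.\<close>

lemma isometric_ip:
  assumes "contractive \<phi>" "isometric \<phi> f" "g \<in> Hs"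
  shows "ip (\<lambda>x. \<phi> x * g x) (\<lambda>x. \<phi> x * f x) = ip g f"
proof -
  have f: "f \<in> Hs" using assms by (simp add: isometric_def)
  obtain S where S: "hyponormal_adjoint \<phi> S"
    using adjoint_exists contractive_multiplier assms(1) by blast
  show ?thesis
    using ip_adjoint[OF S assms(3) contractive_mem[OF assms(1) f]] isometric_adjoint[OF assms(1,2) S] by simp
qed

text \<open>The cross term is preserved by \<open>isometric_ip\<close>. Together with
  \<open>isometric_scale\<close> this makes the vectors at which \<open>\<phi>\<close> is isometric
  a subspace.\<close>

lemma isometric_diff:
  assumes "contractive \<phi>" "isometric \<phi> f" "isometric \<phi> g"
  shows "isometric \<phi> (\<lambda>x. f x - g x)"
proof -
  have m: "f \<in> Hs" "g \<in> Hs" "(\<lambda>x. \<phi> x * f x) \<in> Hs" "(\<lambda>x. \<phi> x * g x) \<in> Hs"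
    using assms contractive_mem by (auto simp: isometric_def)
  have "sq (\<lambda>x. \<phi> x * f x - \<phi> x * g x) = sq (\<lambda>x. f x - g x)"
    using assms by (simp add: sq_diff m isometric_ip) (simp add: isometric_def)
  then show ?thesis using m by (simp add: isometric_def diff_mem right_diff_distrib)
qed

lemma isometric_scale:
  assumes "contractive \<phi>" "isometric \<phi> f"
  shows "isometric \<phi> (\<lambda>x. c * f x)"
proof -
  have "f \<in> Hs" "(\<lambda>x. \<phi> x * f x) \<in> Hs" using assms contractive_mem by (auto simp: isometric_def)
  then have "sq (\<lambda>x. c * (\<phi> x * f x)) = sq (\<lambda>x. c * f x)" "(\<lambda>x. c * f x) \<in> Hs"
    using assms scale_mem by (auto simp: sq_scale isometric_def)
  then show ?thesis by (simp add: isometric_def mult.left_commute)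
qed

text \<open>Since \<open>S\<close> returns \<open>\<phi> f\<close> to \<open>f\<close>, it preserves
  the norm at \<open>\<phi> f\<close>; hyponormality transfers this lower bound from
  \<open>S\<close> to multiplication by \<open>\<phi>\<close>. Hence isometry propagates along all
  powers.\<close>

lemma isometric_mult:
  assumes \<phi>: "contractive \<phi>" and f: "isometric \<phi> f"
  shows "isometric \<phi> (\<lambda>x. \<phi> x * f x)"
proof -
  define h where "h = (\<lambda>x. \<phi> x * f x)"
  have fH: "f \<in> Hs" and fs: "sq h = sq f" using f by (auto simp: isometric_def h_def)
  have h: "h \<in> Hs" unfolding h_def using \<phi> fH contractive_mem by blast
  obtain S where S: "hyponormal_adjoint \<phi> S"
    using adjoint_exists contractive_multiplier \<phi> by blast
  have "sq h \<le> sq (\<lambda>x. \<phi> x * h x)"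
    using sq_adjoint_le[OF S h] isometric_adjoint[OF \<phi> f S] fs by (simp add: h_def)
  then show ?thesis
    using contractive_sq_le[OF \<phi> h] h unfolding isometric_def h_def[symmetric] by simp
qed

lemma isometric_power:
  assumes "contractive \<phi>" "isometric \<phi> f"
  shows "isometric \<phi> (\<lambda>x. \<phi> x ^ n * f x)"
proof (induction n)
  case 0
  then show ?case using assms by simp
next
  case (Suc n)
  from isometric_mult[OF assms(1) this] show ?case by (simp add: mult.assoc)
qed

lemma sq_power:
  assumes "contractive \<phi>" "isometric \<phi> f"
  shows "sq (\<lambda>x. \<phi> x ^ n * f x) = sq f"
proof (induction n)
  case (Suc n)
  then show ?case using isometric_power[OF assms, of n] by (simp add: isometric_def mult.assoc)
qed simp

text \<open>The Gram matrix below is that of the Drury--Arveson space of the two-ball, where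
  \<open>\<parallel>z\<^sub>1 z\<^sub>2\<parallel>\<^sup>2 = 1/2\<close> and \<open>\<parallel>z\<^sub>1\<^sup>2 z\<^sub>2\<^sup>2\<parallel>\<^sup>2 = 1/6\<close>; multiplication by \<open>z\<^sub>1 z\<^sub>2\<close> is not hyponormal
  there, as one sees by testing on \<open>z\<^sub>1 z\<^sub>2\<close> itself.\<close>

lemma no_independent_isometric_row:
  assumes pq: "row_contractive p q" and e: "sq e = 1" and p: "isometric p e"
    and ab: "(cmod a)\<^sup>2 + (cmod b)\<^sup>2 = 1" "b \<noteq> 0" and ipq: "isometric (\<lambda>x. a * p x + b * q x) e"
  shows False
proof -
  have eH: "e \<in> Hs" using p by (simp add: isometric_def)
  have pc: "contractive p" and qc: "contractive q"
    using pq row_contractive_left row_contractive_right by blast+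
  define v where "v i j = (\<lambda>x. p x ^ i * (q x ^ j * e x))" for i j :: nat
  have v: "v i j \<in> Hs" for i j
    unfolding v_def using contractive_power_mem[OF pc contractive_power_mem[OF qc eH]] .
  have orth: "ip (v (Suc n) 0) (v 0 (Suc m)) = 0" for n m
    using row_orthogonal[OF pq isometric_power[OF pc p] contractive_power_mem[OF qc eH], of n m]
    by (simp add: v_def mult.assoc)
  have comb: "sq (\<lambda>x. c * v 1 0 x + d * v 0 1 x) = (cmod c)\<^sup>2 + (cmod d)\<^sup>2 * sq (v 0 1)" for c d
    using orth[of 0 0] p e
    by (simp add: sq_add sq_scale scale_mem v ip_scale_left ip_scale_right)
       (simp add: v_def isometric_def)
  have eqcomb: "(\<lambda>x. (c * p x + d * q x) * e x) = (\<lambda>x. c * v 1 0 x + d * v 0 1 x)" for c d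
    by (simp add: v_def algebra_simps)
  \<comment> \<open>The vectors \<open>p e\<close> and \<open>q e\<close> are orthogonal and
    \<open>p e\<close> has norm 1, so a norm-one combination with \<open>b \<noteq> 0\<close>
    determines the norm of \<open>q e\<close>.\<close>
  have q1: "sq (v 0 1) = 1"
  proof -
    have "(cmod a)\<^sup>2 + (cmod b)\<^sup>2 * sq (v 0 1) = 1"
      using ipq e comb[of a b] by (simp add: isometric_def eqcomb)
    then have "(cmod b)\<^sup>2 * sq (v 0 1) = (cmod b)\<^sup>2 * 1" using ab(1) by linarith
    moreover have "(cmod b)\<^sup>2 \<noteq> 0" using ab(2) by simp
    ultimately show ?thesis using mult_left_cancel by blast
  qed
  \<comment> \<open>After normalising \<open>(c, d)\<close> to a unit vector, the combination is a
    contractive multiplier that is isometric at \<open>e\<close>, so all its powers preserve the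
    norm of \<open>e\<close>.\<close>
  have pow: "sq (\<lambda>x. (c * p x + d * q x) ^ n * e x) = ((cmod c)\<^sup>2 + (cmod d)\<^sup>2) ^ n"
    if "(cmod c)\<^sup>2 + (cmod d)\<^sup>2 > 0" for c d n
  proof -
    define r where "r = sqrt ((cmod c)\<^sup>2 + (cmod d)\<^sup>2)"
    have r: "r > 0" "r\<^sup>2 = (cmod c)\<^sup>2 + (cmod d)\<^sup>2" using that by (simp_all add: r_def)
    define \<psi> where "\<psi> = (\<lambda>x. (c / of_real r) * p x + (d / of_real r) * q x)"
    have unit: "(cmod (c / of_real r))\<^sup>2 + (cmod (d / of_real r))\<^sup>2 = 1"
    proof -
      have "(cmod (c / of_real r))\<^sup>2 + (cmod (d / of_real r))\<^sup>2 = ((cmod c)\<^sup>2 + (cmod d)\<^sup>2) / r\<^sup>2"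
        using r(1) by (simp add: norm_divide power_divide add_divide_distrib)
      also have "\<dots> = 1" using r(1) unfolding r(2)[symmetric] by simp
      finally show ?thesis .
    qed
    have \<psi>: "contractive \<psi>" unfolding \<psi>_def by (rule row_contractive_combine[OF pq unit])
    have "isometric \<psi> e"
      unfolding isometric_def \<psi>_def eqcomb comb q1 using unit e eH by (simp only: mult_1_right)
    then have "sq (\<lambda>x. \<psi> x ^ n * e x) = 1" using sq_power[OF \<psi>] e by simp
    moreover have "(\<lambda>x. (c * p x + d * q x) ^ n * e x) = (\<lambda>x. of_real (r ^ n) * (\<psi> x ^ n * e x))"
    proof
      fix x
      have "c * p x + d * q x = of_real r * \<psi> x" using r by (simp add: \<psi>_def field_simps)
      then show "(c * p x + d * q x) ^ n * e x = of_real (r ^ n) * (\<psi> x ^ n * e x)"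
        by (simp add: power_mult_distrib)
    qed
    ultimately have "sq (\<lambda>x. (c * p x + d * q x) ^ n * e x) = (r ^ n)\<^sup>2"
      using contractive_power_mem[OF \<psi> eH] r(1) by (simp add: sq_scale norm_power)
    also have "\<dots> = (r\<^sup>2) ^ n" by (simp add: power_mult[symmetric] mult.commute)
    finally show ?thesis by (simp only: r(2))
  qed
  have n0: "sq (v n 0) = 1" for n using pow[of 1 0 n] by (simp add: v_def)
  have n1: "sq (v 0 n) = 1" for n using pow[of 0 1 n] by (simp add: v_def)

  have sq11: "sq (v 1 1) = 1/2"
  proof -
    \<comment> \<open>The sum and difference of \<open>f\<close> and \<open>g\<close> are
      \<open>(p + q)^2 e\<close> and \<open>(p - q)^2 e\<close>, so the parallelogram law isolates
      the mixed term.\<close>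
    define f where "f = (\<lambda>x. v 2 0 x + v 0 2 x)"
    define g where "g = (\<lambda>x. 2 * v 1 1 x)"
    have m: "f \<in> Hs" "g \<in> Hs" unfolding f_def g_def by (intro add_mem scale_mem v)+
    have "sq (\<lambda>x. f x + g x) = 4" "sq (\<lambda>x. f x - g x) = 4"
      using pow[of 1 1 2] pow[of 1 "-1" 2]
      by (simp_all add: f_def g_def v_def power2_eq_square algebra_simps)
    moreover have "sq f = 2" using orth[of 1 1] n0[of 2] n1[of 2]
      by (simp add: f_def sq_add v numeral_2_eq_2)
    moreover have "sq g = 4 * sq (v 1 1)" by (simp add: g_def sq_scale v)
    ultimately show ?thesis using parallelogram[OF m] by simp
  qed

  have quartic: "16 * t * sq (v 3 1) + 36 * t^2 * sq (v 2 2) + 16 * t^3 * sq (v 1 3) + 1 + t^4 = (1 + t)^4"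
    if t: "t \<ge> 0" for t :: real
  proof -
    \<comment> \<open>Averaging the squared norm of \<open>(p + d q)^4 e\<close> over
      \<open>d = w, -w, \<i> w, -\<i> w\<close> removes the cross terms except the one between
      \<open>v 4 0\<close> and \<open>v 0 4\<close>, which vanishes by \<open>orth\<close>. The
      average is carried out by parallelogram laws.\<close>
    define w where "w = of_real (sqrt t) * (1::complex)"
    have ww: "w * w = of_real t" using t by (simp add: w_def flip: of_real_mult)
    have wn: "(cmod w)\<^sup>2 = t" using t by (simp add: w_def)
    define E where "E = (\<lambda>x. v 4 0 x + of_real (t^2) * v 0 4 x)"
    define F where "F = (\<lambda>x. of_real (6 * t) * v 2 2 x)"
    define G where "G = (\<lambda>x. (4 * w) * v 3 1 x)"
    define H where "H = (\<lambda>x. (4 * w * of_real t) * v 1 3 x)"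
    have m: "E \<in> Hs" "F \<in> Hs" "G \<in> Hs" "H \<in> Hs"
      unfolding E_def F_def G_def H_def by (intro add_mem scale_mem v)+
    have ti: "of_real t = w * w" using ww by simp
    have pw: "sq (\<lambda>x. (1 * p x + d * q x) ^ 4 * e x) = (1 + t) ^ 4" if "(cmod d)\<^sup>2 = t" for d
      using pow[of 1 d 4] that t by simp
    have A1: "(\<lambda>x. (1 * p x + w * q x) ^ 4 * e x) = (\<lambda>x. (E x + F x) + (G x + H x))"
      by (rule ext) (simp add: E_def F_def G_def H_def v_def ti, algebra)
    have A2: "(\<lambda>x. (1 * p x + (-w) * q x) ^ 4 * e x) = (\<lambda>x. (E x + F x) - (G x + H x))"
      by (rule ext) (simp add: E_def F_def G_def H_def v_def ti, algebra)
    have i2: "\<i> * \<i> = -1" by simp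
    have A3: "(\<lambda>x. (1 * p x + (\<i> * w) * q x) ^ 4 * e x) = (\<lambda>x. (E x - F x) + \<i> * (G x - H x))"
      by (rule ext) (simp add: E_def F_def G_def H_def v_def ti, use i2 in algebra)
    have A4: "(\<lambda>x. (1 * p x + (-\<i> * w) * q x) ^ 4 * e x) = (\<lambda>x. (E x - F x) - \<i> * (G x - H x))"
      by (rule ext) (simp add: E_def F_def G_def H_def v_def ti, use i2 in algebra)
    have 1: "2 * (1 + t)^4 = 2 * sq (\<lambda>x. E x + F x) + 2 * sq (\<lambda>x. G x + H x)"
      using parallelogram[OF add_mem[OF m(1,2)] add_mem[OF m(3,4)]] pw[of w] pw[of "-w"] wn
      unfolding A1 A2 by simp
    have 2: "2 * (1 + t)^4 = 2 * sq (\<lambda>x. E x - F x) + 2 * sq (\<lambda>x. G x - H x)"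
      using parallelogram[OF diff_mem[OF m(1,2)] scale_mem[OF diff_mem[OF m(3,4)]], of \<i>]
        pw[of "\<i> * w"] pw[of "-\<i> * w"] wn
      unfolding A3 A4 by (simp add: norm_mult sq_scale diff_mem m)
    have "4 * (1 + t)^4 = 4 * (sq E + sq F + sq G + sq H)"
      using 1 2 parallelogram[OF m(1,2)] parallelogram[OF m(3,4)] by simp
    moreover have "sq E = 1 + t^4"
      using orth[of 3 3] n0[of 4] n1[of 4]
      by (simp add: E_def sq_add v scale_mem sq_scale ip_scale_right numeral_eq_Suc norm_power norm_mult)
    moreover have "sq F = 36 * t^2 * sq (v 2 2)" "sq G = 16 * t * sq (v 3 1)" "sq H = 16 * t^3 * sq (v 1 3)"
      using t wn by (simp_all add: F_def G_def H_def sq_scale v norm_mult power_mult_distrib)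
        (simp add: power2_eq_square power3_eq_cube)
    ultimately show ?thesis by simp
  qed
  \<comment> \<open>The values \<open>t = 1, 2, 3\<close> give three linear equations for the three
    unknown squared norms.\<close>
  have sq22: "sq (v 2 2) = 1/6"
    using quartic[of 1] quartic[of 2] quartic[of 3] by simp

  have mult: "multiplier Hs (\<lambda>x. p x * q x)"
    unfolding multiplier_def using contractive_mem[OF pc contractive_mem[OF qc]] by (simp add: mult.assoc)
  obtain S where S: "hyponormal_adjoint (\<lambda>x. p x * q x) S" using adjoint_exists mult by blast
  have v11: "(\<lambda>x. p x * q x * e x) = v 1 1" by (simp add: v_def mult.assoc)
  have v22: "(\<lambda>x. p x * q x * v 1 1 x) = v 2 2" by (auto simp: v_def power2_eq_square)
  \<comment> \<open>The component of \<open>S (v 1 1)\<close> along \<open>e\<close> forces a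
    squared norm of at least 1/4, whereas hyponormality allows at most
    \<open>sq (v 2 2) = 1/6\<close>.\<close>
  have "ip e (S (v 1 1)) = of_real (1/2)"
    using ip_adjoint[OF S eH v, of 1 1] ip_self[OF v, of 1 1] unfolding v11 sq11 by simp
  moreover have "(cmod (of_real (1/2)))\<^sup>2 = 1/4" by (simp add: power2_eq_square)
  ultimately have "1/4 \<le> sq (S (v 1 1))"
    using Cauchy_Schwarz[OF eH adjoint_mem[OF S v[of 1 1]]] e by (simp only: mult_1_left)
  then show False using sq_adjoint_le[OF S v[of 1 1]] unfolding v22 sq22 by simp
qed

end

section \<open>Extremal multipliers\<close>

locale hyponormal_pick = hyponormal_rkhs Hs ip K
    for Hs :: "('x \<Rightarrow> complex) set" and ip K +
  fixes x0 :: 'x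
  assumes irr: "irreducible_kernel K" and cnp: "complete_NP Hs ip K"
begin

definition kd :: "'x \<Rightarrow> real" where "kd y = Re (K y y)"

definition e :: "'x \<Rightarrow> complex" where "e x = K x x0 / of_real (sqrt (kd x0))"

text \<open>The component of the kernel function at \<open>y\<close> orthogonal to \<open>e\<close>,
  that is, the kernel function at \<open>y\<close> of the subspace of functions vanishing at
  \<open>x0\<close>. In terms of the function \<open>L\<close> above, it is
  \<open>L(x,y) K(x,y)\<close>.\<close>

definition proj :: "'x \<Rightarrow> 'x \<Rightarrow> complex" where "proj y x = K x y - cnj (e y) * e x"

lemma K_nonzero: "K x y \<noteq> 0"
  using irr by (simp add: irreducible_kernel_def)

lemma K_self: "K y y = of_real (kd y)"
  using ip_self[OF kernel_mem, of y] ip_kernel[OF kernel_mem, of y y] by (simp add: kd_def complex_eq_iff)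

lemma sq_kernel: "sq (\<lambda>x. K x y) = kd y"
  by (simp add: sq_def ip_kernel kernel_mem kd_def)

lemma kd_pos: "kd y > 0"
  using K_self[of y] K_nonzero[of y y] sq_kernel[of y] sq_nonneg[OF kernel_mem, of y]
  by (metis of_real_0 order_le_less)

lemma K_commute: "K y x = cnj (K x y)"
  using ip_commute[OF kernel_mem kernel_mem, of y x] by (simp add: ip_kernel kernel_mem)

lemma sqrt_sq: "of_real (sqrt (kd x0)) * of_real (sqrt (kd x0)) = (of_real (kd x0) :: complex)"
  using kd_pos[of x0] by (simp flip: of_real_mult)

lemma e_nonzero: "e x \<noteq> 0"
  using K_nonzero kd_pos[of x0] by (simp add: e_def)

lemma e_eq: "e = (\<lambda>x. (1 / of_real (sqrt (kd x0))) * K x x0)"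
  by (simp add: e_def[abs_def])

lemma e_mem: "e \<in> Hs"
  unfolding e_eq by (intro scale_mem kernel_mem)

lemma ip_e: "f \<in> Hs \<Longrightarrow> ip f e = f x0 / of_real (sqrt (kd x0))"
  using ip_scale_right[OF kernel_mem, of f "1 / of_real (sqrt (kd x0))" x0]
  by (simp add: ip_kernel flip: e_eq) (simp add: e_def[abs_def])

lemma e_self: "e x0 = of_real (sqrt (kd x0))"
  using sqrt_sq kd_pos[of x0] by (simp add: e_def K_self field_simps)

lemma sq_e: "sq e = 1"
  using kd_pos[of x0] by (simp add: sq_def ip_e e_mem e_self)

lemma e_base: "e x * cnj (e x0) = K x x0"
  using kd_pos[of x0] by (simp add: e_self) (simp add: e_def)

lemma proj_mem: "proj y \<in> Hs"
  unfolding proj_def[abs_def] by (intro diff_mem scale_mem kernel_mem e_mem)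

lemma sq_proj: "sq (proj y) = kd y - (cmod (e y))\<^sup>2"
proof -
  have "ip (\<lambda>x. K x y) e = cnj (e y)"
    using ip_commute[OF e_mem kernel_mem, of y] by (simp add: ip_kernel e_mem)
  then have "ip (\<lambda>x. K x y) (\<lambda>x. cnj (e y) * e x) = of_real ((cmod (e y))\<^sup>2)"
    by (simp add: ip_scale_right e_mem kernel_mem complex_norm_square del: of_real_power)
  then show ?thesis
    unfolding proj_def[abs_def]
    by (simp add: sq_diff kernel_mem scale_mem e_mem sq_scale sq_e sq_kernel del: of_real_power)
qed

text \<open>If \<open>proj y\<close> vanished, the kernel functions at \<open>y\<close> and
  \<open>x0\<close> would be linearly dependent.\<close>

lemma sq_proj_pos:
  assumes "y \<noteq> x0"
  shows "sq (proj y) > 0"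
proof (rule ccontr)
  assume "\<not> ?thesis"
  then have "sq (proj y) = 0" using sq_nonneg[OF proj_mem, of y] by simp
  then have "proj y = (\<lambda>x. 0)" using sq_eq_0 proj_mem by blast
  then have "(\<lambda>z. 1 * K z y + (- cnj (e y) / of_real (sqrt (kd x0))) * K z x0) = (\<lambda>z. 0)"
    by (auto simp: proj_def e_def fun_eq_iff)
  then show False using irr assms unfolding irreducible_kernel_def by (metis one_neq_zero)
qed

text \<open>Kernel functions are eigenvectors of the adjoint, with eigenvalue the conjugate of the
  value of \<open>\<phi>\<close>; the component along \<open>e\<close>, a multiple of the kernel
  function at \<open>x0\<close>, is annihilated.\<close>

lemma adjoint_proj:
  assumes "contractive \<phi>" "\<phi> x0 = 0" "hyponormal_adjoint \<phi> S"
  shows "S (proj y) = (\<lambda>x. cnj (\<phi> y) * K x y)"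
proof (rule ip_ext)
  fix f assume f: "f \<in> Hs"
  have m: "(\<lambda>x. \<phi> x * f x) \<in> Hs" using contractive_mem assms f by blast
  have "ip f (S (proj y)) = ip (\<lambda>x. \<phi> x * f x) (proj y)"
    using ip_adjoint[OF assms(3) f proj_mem, of y] by simp
  also have "\<dots> = \<phi> y * f y"
    unfolding proj_def[abs_def] using assms(2) m
    by (simp add: ip_diff_right kernel_mem scale_mem e_mem ip_kernel ip_scale_right ip_e)
  finally show "ip f (S (proj y)) = ip f (\<lambda>x. cnj (\<phi> y) * K x y)"
    by (simp add: ip_scale_right kernel_mem ip_kernel f)
qed (simp_all add: adjoint_mem[OF assms(3)] kernel_mem scale_mem proj_mem)

text \<open>The left-hand side is the squared norm of the adjoint applied to \<open>proj y\<close>,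
  and the adjoint is contractive.\<close>

lemma Schwarz_Pick:
  assumes "contractive \<phi>" "\<phi> x0 = 0"
  shows "(cmod (\<phi> y))\<^sup>2 * kd y \<le> sq (proj y)"
proof -
  obtain S where S: "hyponormal_adjoint \<phi> S"
    using adjoint_exists contractive_multiplier assms(1) by blast
  have "(cmod (\<phi> y))\<^sup>2 * kd y = sq (S (proj y))"
    by (simp add: adjoint_proj[OF assms S] sq_scale kernel_mem sq_kernel)
  also have "\<dots> \<le> sq (proj y)"
    using sq_adjoint_le[OF S proj_mem] contractive_sq_le[OF assms(1) proj_mem] by (rule order_trans)
  finally show ?thesis .
qed

text \<open>Equality in the Schwarz--Pick inequality means that the adjoint of \<open>M\<^sub>\<phi>\<close> attains its norm at
  \<open>proj y\<close>; hyponormality then forces \<open>M\<^sub>\<phi>\<close> to be isometric there.\<close>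

lemma Schwarz_Pick_equality:
  assumes \<phi>: "contractive \<phi>" "\<phi> x0 = 0" and y: "y \<noteq> x0" and eq: "(cmod (\<phi> y))\<^sup>2 * kd y = sq (proj y)"
  shows "\<phi> x * cnj (\<phi> y) * K x y = proj y x" and "isometric \<phi> e"
proof -
  obtain S where S: "hyponormal_adjoint \<phi> S"
    using adjoint_exists contractive_multiplier \<phi>(1) by blast
  define k where "k = (\<lambda>x. cnj (\<phi> y) * K x y)"
  have Sg: "S (proj y) = k" unfolding k_def by (rule adjoint_proj[OF \<phi> S])
  have k: "k \<in> Hs" unfolding k_def by (intro scale_mem kernel_mem)
  have sk: "sq k = sq (proj y)" by (simp add: k_def sq_scale kernel_mem sq_kernel eq)
  have \<phi>k: "(\<lambda>x. \<phi> x * k x) \<in> Hs" using contractive_mem \<phi>(1) k by blast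
  \<comment> \<open>Both \<open>\<phi> k\<close> and \<open>proj y\<close> have norm at most that of
    \<open>k\<close>, while their inner product is its square; so they are equal.\<close>
  have "ip (\<lambda>x. \<phi> x * k x) (proj y) = of_real (sq k)"
    using ip_adjoint[OF S k proj_mem, of y] ip_self[OF k] by (simp add: Sg)
  then have "sq (\<lambda>x. \<phi> x * k x - proj y x) \<le> 0"
    using contractive_sq_le[OF \<phi>(1) k] sk by (simp add: sq_diff \<phi>k proj_mem)
  then have "sq (\<lambda>x. \<phi> x * k x - proj y x) = 0"
    using sq_nonneg[OF diff_mem[OF \<phi>k proj_mem], of y] by simp
  then have "(\<lambda>x. \<phi> x * k x - proj y x) = (\<lambda>x. 0)"
    using sq_eq_0[OF diff_mem[OF \<phi>k proj_mem]] by blast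
  then have \<phi>k_eq: "(\<lambda>x. \<phi> x * k x) = proj y" by (simp add: fun_eq_iff)
  then show "\<phi> x * cnj (\<phi> y) * K x y = proj y x" by (auto simp: k_def fun_eq_iff mult.assoc)
  have nz: "\<phi> y \<noteq> 0" using sq_proj_pos[OF y] eq by auto
  have iso_k: "isometric \<phi> k" using \<phi>k_eq sk k by (simp add: isometric_def)
  have iso_p: "isometric \<phi> (proj y)"
    using sq_adjoint_le[OF S proj_mem, of y] contractive_sq_le[OF \<phi>(1) proj_mem, of y] sk Sg
    by (simp add: isometric_def proj_mem)
  \<comment> \<open>The vector \<open>k\<close> is a nonzero multiple of the kernel function at
    \<open>y\<close>, so \<open>e\<close> lies in the span of \<open>k\<close> and
    \<open>proj y\<close>, at both of which \<open>\<phi>\<close> is isometric.\<close>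
  have "(\<lambda>x. (1 / cnj (e y)) * ((1 / cnj (\<phi> y)) * k x - proj y x)) = e"
    using nz e_nonzero[of y] by (simp add: k_def proj_def fun_eq_iff)
  then show "isometric \<phi> e"
    using isometric_scale[OF \<phi>(1) isometric_diff[OF \<phi>(1) isometric_scale[OF \<phi>(1) iso_k] iso_p]]
    by metis
qed

text \<open>A two-point Pick problem with value 0 at \<open>x0\<close> and the largest value at
  \<open>y\<close> permitted by \<open>Schwarz_Pick\<close>; its Pick matrix is exactly the rank-one
  matrix of the values of \<open>e\<close>.\<close>

lemma extremal_multiplier:
  assumes y: "y \<noteq> x0"
  obtains \<phi> where "contractive \<phi>" "\<phi> x0 = 0" "(cmod (\<phi> y))\<^sup>2 * kd y = sq (proj y)"
proof -
  define d where "d = sqrt (sq (proj y) / kd y)"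
  have d: "d * d * kd y = kd y - (cmod (e y))\<^sup>2"
    using sq_proj_pos[OF y] kd_pos[of y] by (simp add: d_def sq_proj)
  define z where "z i = (if i = 0 then x0 else y)" for i :: nat
  define \<alpha> where "\<alpha> i = (if i = 0 then 0 else complex_of_real d)" for i :: nat
  have "(1 - of_real d * of_real d) * K y y = of_real (kd y - d * d * kd y)"
    by (simp add: K_self algebra_simps)
  also have "\<dots> = e y * cnj (e y)" unfolding d by (simp add: complex_norm_square del: of_real_power)
  finally have 1: "(1 - of_real d * of_real d) * K y y = e y * cnj (e y)" .
  have 2: "K x0 y = e x0 * cnj (e y)" using e_base[of y] K_commute[of x0 y] by (metis complex_cnj_cnj complex_cnj_mult mult.commute)
  have pick: "(1 - \<alpha> i * cnj (\<alpha> j) - (\<lambda>_. 0) i * cnj ((\<lambda>_. 0) j)) * K (z i) (z j) = e (z i) * cnj (e (z j))"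
    for i j using 1 2 e_base[of y] e_base[of x0] by (auto simp: z_def \<alpha>_def)
  obtain p q where p: "row_contractive p q" and v: "\<And>i. i < 2 \<Longrightarrow> p (z i) = \<alpha> i"
    by (rule row_interpolation[OF cnp, where n = 2 and z = z and \<alpha> = \<alpha> and \<beta> = "\<lambda>_. 0" and e = e])
      (use pick in auto)
  have "p x0 = 0" "p y = of_real d" using v[of 0] v[of 1] by (auto simp: z_def \<alpha>_def)
  moreover have "(cmod (of_real d))\<^sup>2 * kd y = sq (proj y)"
    using d by (simp add: sq_proj power2_eq_square)
  ultimately show thesis using that[of p] row_contractive_left[OF p] by metis
qed

text \<open>A defect at \<open>w\<close> can be filled by a second row entry, producing a
  contractive row with one unit combination extremal at \<open>y\<close> and an independent one
  extremal at \<open>w\<close>. Both are isometric at \<open>e\<close>, which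
  \<open>no_independent_isometric_row\<close> excludes.\<close>

lemma extremal_everywhere:
  assumes \<phi>: "contractive \<phi>" "\<phi> x0 = 0" and y: "y \<noteq> x0" and eq: "(cmod (\<phi> y))\<^sup>2 * kd y = sq (proj y)"
  shows "(cmod (\<phi> w))\<^sup>2 * kd w = sq (proj w)"
proof (rule ccontr)
  assume neq: "\<not> ?thesis"
  have c: "\<phi> x * cnj (\<phi> y) * K x y = proj y x" for x
    using Schwarz_Pick_equality(1)[OF \<phi> y eq] .
  have wo: "w \<noteq> x0"
  proof
    assume "w = x0"
    then show False using neq \<phi>(2) kd_pos[of x0] by (simp add: sq_proj e_self)
  qed
  \<comment> \<open>The gap in the Schwarz-Pick inequality at \<open>w\<close>, as a squared
    modulus; \<open>s\<close> is the value given to the second entry at \<open>w\<close>.\<close>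
  define s2 where "s2 = (sq (proj w) - (cmod (\<phi> w))\<^sup>2 * kd w) / kd w"
  define s where "s = sqrt s2"
  have s2: "s2 > 0"
    using Schwarz_Pick[OF \<phi>, of w] neq kd_pos[of w] by (simp add: s2_def)
  then have s: "s > 0" "s * s = s2" by (simp_all add: s_def)
  define z where "z i = (if i = 0 then x0 else if i = 1 then y else w)" for i :: nat
  define \<alpha> where "\<alpha> i = \<phi> (z i)" for i
  define \<beta> where "\<beta> i = (if i = 2 then complex_of_real s else 0)" for i :: nat
  have self: "(1 - \<phi> u * cnj (\<phi> u)) * K u u = of_real (kd u - (cmod (\<phi> u))\<^sup>2 * kd u)" for u
    by (simp add: K_self complex_norm_square algebra_simps del: of_real_power)
  have 1: "(1 - \<phi> y * cnj (\<phi> y)) * K y y = e y * cnj (e y)"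
    unfolding self eq sq_proj by (simp add: complex_norm_square del: of_real_power)
  have 2: "(1 - \<phi> w * cnj (\<phi> y)) * K w y = e w * cnj (e y)"
    using c[of w] by (simp add: proj_def algebra_simps)
  have 3: "(1 - \<phi> y * cnj (\<phi> w)) * K y w = e y * cnj (e w)"
    using arg_cong[OF 2, of cnj] K_commute[of y w] by (simp add: mult.commute)
  have 4: "(1 - \<phi> w * cnj (\<phi> w) - of_real s * of_real s) * K w w = e w * cnj (e w)"
  proof -
    have "s * s * kd w = kd w - (cmod (e w))\<^sup>2 - (cmod (\<phi> w))\<^sup>2 * kd w"
      using kd_pos[of w] by (simp add: s s2_def sq_proj)
    then have "of_real (kd w - (cmod (\<phi> w))\<^sup>2 * kd w) - complex_of_real (s * s * kd w) = of_real ((cmod (e w))\<^sup>2)"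
      by (simp flip: of_real_diff)
    moreover have "(1 - \<phi> w * cnj (\<phi> w) - of_real s * of_real s) * K w w
        = (1 - \<phi> w * cnj (\<phi> w)) * K w w - of_real (s * s * kd w)"
      by (simp add: K_self algebra_simps)
    ultimately show ?thesis by (simp only: self complex_norm_square)
  qed
  have 5: "K x0 u = e x0 * cnj (e u)" for u
    using e_base[of u] K_commute[of x0 u] by (metis complex_cnj_cnj complex_cnj_mult mult.commute)
  have pick: "(1 - \<alpha> i * cnj (\<alpha> j) - \<beta> i * cnj (\<beta> j)) * K (z i) (z j) = e (z i) * cnj (e (z j))"
    if "i < 3" "j < 3" for i j
  proof -
    have "i \<in> {0, 1, 2}" "j \<in> {0, 1, 2}" using that by auto
    then show ?thesis using 1 2 3 4 5 e_base \<phi>(2) by (auto simp: z_def \<alpha>_def \<beta>_def)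
  qed
  obtain p q where pq: "row_contractive p q"
    and pv: "\<And>i. i < 3 \<Longrightarrow> p (z i) = \<alpha> i" and qv: "\<And>i. i < 3 \<Longrightarrow> q (z i) = \<beta> i"
    by (rule row_interpolation[OF cnp, where n = 3 and z = z and \<alpha> = \<alpha> and \<beta> = \<beta> and e = e])
      (use pick in auto)
  have val: "p x0 = 0" "p y = \<phi> y" "p w = \<phi> w" "q x0 = 0" "q w = of_real s"
    using pv[of 0] pv[of 1] pv[of 2] qv[of 0] qv[of 2] \<phi>(2) by (auto simp: z_def \<alpha>_def \<beta>_def)
  have p: "isometric p e"
    using Schwarz_Pick_equality(2)[OF row_contractive_left[OF pq] val(1) y] eq val(2) by simp
  define r where "r = sqrt ((cmod (\<phi> w))\<^sup>2 + s2)"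
  have r: "r > 0" "r\<^sup>2 = (cmod (\<phi> w))\<^sup>2 + s2" using s2 by (simp_all add: r_def add_nonneg_pos)
  \<comment> \<open>The unit vector \<open>(a, b)\<close> is the conjugate of the direction of the
    row value \<open>(\<phi> w, s)\<close>, so the combination takes at \<open>w\<close> the full
    length \<open>r\<close> of that value.\<close>
  define a where "a = cnj (\<phi> w) / of_real r"
  define b where "b = complex_of_real (s / r)"
  have "(cmod a)\<^sup>2 + (cmod b)\<^sup>2 = ((cmod (\<phi> w))\<^sup>2 + s\<^sup>2) / r\<^sup>2"
    using r(1) by (simp add: a_def b_def norm_divide power_divide add_divide_distrib)
  also have "(cmod (\<phi> w))\<^sup>2 + s\<^sup>2 = r\<^sup>2" using s r by (simp add: power2_eq_square)
  finally have ab: "(cmod a)\<^sup>2 + (cmod b)\<^sup>2 = 1" using r(1) by simp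
  have b0: "b \<noteq> 0" using s r by (simp add: b_def)
  have "complex_of_real (r\<^sup>2 / r) = (\<phi> w * cnj (\<phi> w) + of_real (s * s)) / of_real r"
    unfolding r(2) s(2) of_real_divide of_real_add complex_norm_square ..
  also have "\<dots> = a * \<phi> w + b * of_real s"
    by (simp add: a_def b_def add_divide_distrib mult.commute)
  finally have "a * \<phi> w + b * of_real s = of_real (r\<^sup>2 / r)" by simp
  then have w': "a * p w + b * q w = of_real r" using val r(1) by (simp add: power2_eq_square)
  have "r\<^sup>2 * kd w = sq (proj w)"
    using kd_pos[of w] by (simp add: r(2) s2_def field_simps)
  then have "isometric (\<lambda>x. a * p x + b * q x) e"
    using Schwarz_Pick_equality(2)[OF row_contractive_combine[OF pq ab] _ wo] val w' by simp
  then show False using no_independent_isometric_row[OF pq sq_e p ab b0] by blast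
qed

text \<open>Extremality at every \<open>w\<close> gives the product formula for all pairs of points;
  solving it for \<open>K\<close> yields the Szego form. The formula at the fixed \<open>y\<close>
  is kept since it expresses \<open>\<phi>\<close> through \<open>K\<close>, for the regularity
  claims.\<close>

lemma kernel_form:
  assumes "y \<noteq> x0"
  obtains \<phi> where "contractive \<phi>" "isometric \<phi> e" "\<phi> x0 = 0" "\<phi> y \<noteq> 0"
    "\<And>x. \<phi> x * cnj (\<phi> y) = 1 - e x * cnj (e y) / K x y"
    "\<And>x w. K x w = e x * cnj (e w) * szego (\<phi> x) (\<phi> w)"
    "\<And>x. cmod (\<phi> x) < 1"
proof -
  obtain \<phi> where \<phi>: "contractive \<phi>" "\<phi> x0 = 0" and eq: "(cmod (\<phi> y))\<^sup>2 * kd y = sq (proj y)"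
    using extremal_multiplier[OF assms] by blast
  have ev: "(cmod (\<phi> w))\<^sup>2 * kd w = sq (proj w)" for w
    using extremal_everywhere[OF \<phi> assms eq] .
  have prod: "(1 - \<phi> x * cnj (\<phi> w)) * K x w = e x * cnj (e w)" for x w
  proof (cases "w = x0")
    case True
    then show ?thesis using e_base[of x] \<phi>(2) by simp
  next
    case False
    show ?thesis
      using Schwarz_Pick_equality(1)[OF \<phi> False ev, of x] by (simp add: proj_def algebra_simps)
  qed
  have "K x w = e x * cnj (e w) * szego (\<phi> x) (\<phi> w)" for x w
  proof -
    have "1 - \<phi> x * cnj (\<phi> w) \<noteq> 0" using prod[of x w] e_nonzero[of x] e_nonzero[of w] by auto
    then show ?thesis using prod[of x w] by (simp add: szego_def field_simps)
  qed
  moreover have "\<phi> x * cnj (\<phi> y) = 1 - e x * cnj (e y) / K x y" for x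
    using prod[of x y] K_nonzero[of x y] by (simp add: field_simps)
  moreover have "cmod (\<phi> x) < 1" for x
  proof -
    have "(cmod (\<phi> x))\<^sup>2 * kd x < 1 * kd x" using e_nonzero[of x] by (simp add: ev sq_proj)
    then have "(cmod (\<phi> x))\<^sup>2 < 1\<^sup>2" using kd_pos[of x] by simp
    then show ?thesis by (rule power_less_imp_less_base) simp
  qed
  moreover have "\<phi> y \<noteq> 0" using sq_proj_pos[OF assms] eq by auto
  moreover have "isometric \<phi> e" using Schwarz_Pick_equality(2)[OF \<phi> assms eq] .
  ultimately show thesis using that \<phi> by blast
qed

end

section \<open>The model on the Hardy space\<close>

text \<open>Square-summable coefficients are bounded, so a geometric series dominates inside the
  disc.\<close>

lemma H2_coeffs_suminf:
  assumes "summable (\<lambda>n. (cmod (a n))\<^sup>2)"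
  shows "H2_coeffs (\<lambda>z. \<Sum>n. a n * z ^ n) a"
  unfolding H2_coeffs_def
proof (intro conjI ballI assms summable_sums)
  fix z :: complex assume z: "z \<in> ball 0 1"
  have "(\<lambda>n. sqrt ((cmod (a n))\<^sup>2)) \<longlonglongrightarrow> sqrt 0"
    by (intro tendsto_real_sqrt summable_LIMSEQ_zero assms)
  then have "Bseq a" by (intro convergent_imp_Bseq convergentI[of _ 0]) (simp add: tendsto_norm_zero_iff)
  then obtain M where M: "\<And>n. cmod (a n) \<le> M" by (auto simp: Bseq_def)
  have "summable (\<lambda>n. M * cmod z ^ n)" using z by (intro summable_mult summable_geometric) simp
  then show "summable (\<lambda>n. a n * z ^ n)"
    by (rule summable_comparison_test') (use M in \<open>auto simp: norm_mult norm_power intro: mult_right_mono\<close>)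
qed

lemma H2_coeffs_geometric:
  assumes "cmod w < 1"
  shows "H2_coeffs (\<lambda>z. c * szego z w) (\<lambda>n. c * cnj w ^ n)"
  unfolding H2_coeffs_def
proof (intro conjI ballI)
  have "(cmod w)\<^sup>2 < 1" using assms by (simp add: power_less_one_iff)
  then have "summable (\<lambda>n. (cmod c)\<^sup>2 * ((cmod w)\<^sup>2) ^ n)"
    by (intro summable_mult summable_geometric) simp
  then show "summable (\<lambda>n. (cmod (c * cnj w ^ n))\<^sup>2)"
    by (simp add: norm_mult norm_power power_mult_distrib power_mult[symmetric] mult.commute)
next
  fix z :: complex assume "z \<in> ball 0 1"
  then have "cmod (z * cnj w) < 1"
    using assms by (simp add: norm_mult) (metis mult_strict_mono' mult_1 norm_ge_zero)
  from sums_mult[OF geometric_sums[OF this], of c]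
  show "(\<lambda>n. c * cnj w ^ n * z ^ n) sums (c * szego z w)"
    by (simp add: szego_def power_mult_distrib mult_ac)
qed

lemma singleton_not_uniqueness_set_H2: "\<not> uniqueness_set_H2 {c}"
proof
  assume u: "uniqueness_set_H2 {c}"
  define a where "a n = (if n = 0 then - c else if n = 1 then 1 else 0)" for n :: nat
  have "H2_coeffs (\<lambda>z. z - c) a"
    unfolding H2_coeffs_def
  proof (intro conjI ballI)
    show "summable (\<lambda>n. (cmod (a n))\<^sup>2)" by (rule summable_finite[of "{0,1}"]) (auto simp: a_def)
    fix z :: complex
    have "(\<lambda>n. a n * z ^ n) sums (\<Sum>n\<in>{0,1}. a n * z ^ n)" by (rule sums_finite) (auto simp: a_def)
    then show "(\<lambda>n. a n * z ^ n) sums (z - c)" by (simp add: a_def)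
  qed
  then have "(\<lambda>z. z - c) \<in> H2" unfolding H2_def by blast
  moreover have "\<forall>f\<in>H2. f c = 0 \<longrightarrow> (\<forall>z\<in>ball 0 1. f z = 0)"
    using u by (simp add: uniqueness_set_H2_def)
  ultimately have "\<forall>z\<in>ball 0 1. z - c = 0" by fastforce
  \<comment> \<open>The function \<open>z - c\<close> cannot vanish at both 0 and 1/2.\<close>
  then have "(0::complex) \<in> ball 0 1 \<longrightarrow> 0 - c = 0" "(1/2::complex) \<in> ball 0 1 \<longrightarrow> 1/2 - c = 0" by blast+
  then show False by (simp add: norm_divide)
qed

text \<open>The expression has the shape in which the embedding is recovered from two kernel
  functions.\<close>

lemma continuous_map_moebius:
  fixes f g :: "'x \<Rightarrow> complex"
  assumes "continuous_map T euclidean f" "continuous_map T euclidean g" "\<And>x. g x \<noteq> 0" "d \<noteq> 0"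
  shows "continuous_map T euclidean (\<lambda>x. (1 - c * f x / g x) / d)"
  using assms unfolding continuous_map_atin limitin_canonical_iff
  by (intro ballI tendsto_divide tendsto_diff tendsto_mult tendsto_const) simp_all

lemma holo_on_set_moebius:
  fixes f g :: "complex ^ 'n \<Rightarrow> complex"
  assumes f: "holo_on_set f S" and g: "holo_on_set g S" and nz: "\<And>w. w \<in> S \<Longrightarrow> g w \<noteq> 0" and d: "d \<noteq> 0"
  shows "holo_on_set (\<lambda>w. (1 - c * f w / g w) / d) S"
  unfolding holo_on_set_def
proof
  fix z assume z: "z \<in> S"
  obtain U F where U: "z \<in> U" "holo_open F U" "\<forall>w\<in>U \<inter> S. F w = f w"
    using f z unfolding holo_on_set_def by blast
  obtain V G where V: "z \<in> V" "holo_open G V" "\<forall>w\<in>V \<inter> S. G w = g w"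
    using g z unfolding holo_on_set_def by blast
  \<comment> \<open>The local extension \<open>G\<close> may have zeros off \<open>S\<close>, so the
    neighbourhood is shrunk to where the quotient is defined.\<close>
  define W where "W = U \<inter> (V \<inter> G -` (- {0}))"
  have "continuous_on V G"
    using V(2) unfolding holo_open_def
    by (meson continuous_at_imp_continuous_on has_derivative_continuous)
  then have "open W"
    using U(2) V(2) unfolding W_def holo_open_def
    by (intro open_Int continuous_open_preimage) auto
  moreover have "\<exists>D. ((\<lambda>w. (1 - c * F w / G w) / d) has_derivative D) (at w) \<and> (\<forall>k v. D (k *s v) = k * D v)"
    if w: "w \<in> W" for w
  proof -
    have Gw: "G w \<noteq> 0" using w by (simp add: W_def)
    obtain D1 where D1: "(F has_derivative D1) (at w)" "\<forall>k v. D1 (k *s v) = k * D1 v"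
      using U(2) w unfolding holo_open_def W_def by blast
    obtain D2 where D2: "(G has_derivative D2) (at w)" "\<forall>k v. D2 (k *s v) = k * D2 v"
      using V(2) w unfolding holo_open_def W_def by blast
    define D where "D h = - (c * (D1 h * G w - F w * D2 h) / (G w * G w)) / d" for h
    have "((\<lambda>w. (1 - c * F w / G w) / d) has_derivative D) (at w)"
      unfolding D_def[abs_def]
      by (rule derivative_eq_intros D1 D2 Gw refl)+ (use d Gw in \<open>auto simp: field_simps\<close>)
    moreover have "\<forall>k v. D (k *s v) = k * D v" using D1(2) D2(2) by (simp add: D_def algebra_simps)
    ultimately show ?thesis by blast
  qed
  ultimately have "holo_open (\<lambda>w. (1 - c * F w / G w) / d) W" by (simp add: holo_open_def)
  moreover have "z \<in> W" using U V z nz by (auto simp: W_def)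
  moreover have "\<forall>w\<in>W \<inter> S. (1 - c * F w / G w) / d = (1 - c * f w / g w) / d"
    using U(3) V(3) by (simp add: W_def)
  ultimately show "\<exists>U G. z \<in> U \<and> holo_open G U \<and> (\<forall>w\<in>U \<inter> S. G w = (1 - c * f w / g w) / d)"
    by (intro exI conjI)
qed

section \<open>The unitary from the Hardy space\<close>

context hyponormal_pick
begin

text \<open>Common factors \<open>\<phi>\<close> cancel by \<open>isometric_ip\<close>. What remains
  is an inner product with \<open>e\<close>, a multiple of evaluation at \<open>x0\<close>, where
  positive powers of \<open>\<phi>\<close> vanish.\<close>

lemma orthonormal_powers:
  assumes \<phi>: "contractive \<phi>" "isometric \<phi> e" "\<phi> x0 = 0"
  shows "ip (\<lambda>x. \<phi> x ^ m * e x) (\<lambda>x. \<phi> x ^ n * e x) = (if m = n then 1 else 0)"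
proof -
  have mem: "(\<lambda>x. \<phi> x ^ n * e x) \<in> Hs" for n using contractive_power_mem \<phi>(1) e_mem by blast
  have shift: "ip (\<lambda>x. \<phi> x ^ n * g x) (\<lambda>x. \<phi> x ^ n * e x) = ip g e" if g: "g \<in> Hs" for g n
  proof (induction n)
    case (Suc n)
    then show ?case
      using isometric_ip[OF \<phi>(1) isometric_power[OF \<phi>(1,2)] contractive_power_mem[OF \<phi>(1) g], of n n]
      by (simp add: mult.assoc)
  qed simp
  have gt: "ip (\<lambda>x. \<phi> x ^ m * e x) (\<lambda>x. \<phi> x ^ n * e x) = 0" if "n < m" for m n
  proof -
    have "(\<lambda>x. \<phi> x ^ m * e x) = (\<lambda>x. \<phi> x ^ n * (\<phi> x ^ (m - n) * e x))"
      using that by (simp add: mult.assoc[symmetric] flip: power_add)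
    then show ?thesis using shift[OF mem, of n "m - n"] that \<phi>(3) by (simp add: ip_e mem)
  qed
  consider "m = n" | "n < m" | "m < n" by linarith
  then show ?thesis
  proof cases
    case 1
    then show ?thesis using shift[OF e_mem, of n] ip_self[OF e_mem] sq_e by simp
  next
    case 2
    then show ?thesis using gt by simp
  next
    case 3
    then show ?thesis using gt[OF 3] ip_commute[OF mem mem, of n m] by simp
  qed
qed

text \<open>The series with coefficients \<open>a\<close> in the orthonormal vectors
  \<open>\<phi>^n e\<close> converges in the space; pairing it with kernel functions identifies its
  sum pointwise.\<close>

lemma H2_lift:
  assumes \<phi>: "contractive \<phi>" "isometric \<phi> e" "\<phi> x0 = 0" "\<And>x. cmod (\<phi> x) < 1"
    and f: "H2_coeffs f a"
  shows "(\<lambda>x. e x * f (\<phi> x)) \<in> Hs" "sq (\<lambda>x. e x * f (\<phi> x)) = (\<Sum>n. (cmod (a n))\<^sup>2)"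
    "g \<in> Hs \<Longrightarrow> (\<lambda>k. a k * ip (\<lambda>x. \<phi> x ^ k * e x) g) sums ip (\<lambda>x. e x * f (\<phi> x)) g"
    "ip (\<lambda>x. e x * f (\<phi> x)) (\<lambda>x. \<phi> x ^ n * e x) = a n"
proof -
  define u where "u n = (\<lambda>x. \<phi> x ^ n * e x)" for n
  have u: "u n \<in> Hs" for n unfolding u_def using contractive_power_mem \<phi>(1) e_mem by blast
  have uu: "ip (u m) (u n) = (if m = n then 1 else 0)" for m n
    unfolding u_def by (rule orthonormal_powers[OF \<phi>(1-3)])
  have a: "summable (\<lambda>n. (cmod (a n))\<^sup>2)" using f by (simp add: H2_coeffs_def)
  obtain h where h: "h \<in> Hs" "\<And>g. g \<in> Hs \<Longrightarrow> (\<lambda>k. a k * ip (u k) g) sums ip h g"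
    "\<And>n. ip h (u n) = a n" "sq h = (\<Sum>n. (cmod (a n))\<^sup>2)"
    by (rule orthonormal_series[OF u uu a]) blast
  have "h y = e y * f (\<phi> y)" for y
  proof -
    have "(\<lambda>k. a k * (\<phi> y ^ k * e y)) sums h y"
      using h(2)[OF kernel_mem, of y] by (simp add: ip_kernel h(1) u) (simp add: u_def)
    moreover have "(\<lambda>k. a k * \<phi> y ^ k * e y) sums (f (\<phi> y) * e y)"
      using f \<phi>(4)[of y] by (intro sums_mult2) (simp add: H2_coeffs_def)
    ultimately show ?thesis by (simp add: mult.assoc) (metis sums_unique2 mult.commute)
  qed
  then have "h = (\<lambda>x. e x * f (\<phi> x))" by auto
  then show "(\<lambda>x. e x * f (\<phi> x)) \<in> Hs" "sq (\<lambda>x. e x * f (\<phi> x)) = (\<Sum>n. (cmod (a n))\<^sup>2)"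
    "g \<in> Hs \<Longrightarrow> (\<lambda>k. a k * ip (\<lambda>x. \<phi> x ^ k * e x) g) sums ip (\<lambda>x. e x * f (\<phi> x)) g"
    "ip (\<lambda>x. e x * f (\<phi> x)) (\<lambda>x. \<phi> x ^ n * e x) = a n"
    using h unfolding u_def by blast+
qed

lemma H2_lift_surj:
  assumes \<phi>: "contractive \<phi>" "isometric \<phi> e" "\<phi> x0 = 0" "\<And>x. cmod (\<phi> x) < 1"
    and K: "\<And>x w. K x w = e x * cnj (e w) * szego (\<phi> x) (\<phi> w)" and g: "g \<in> Hs"
  shows "\<exists>f\<in>H2. \<forall>x. g x = e x * f (\<phi> x)"
proof -
  define a where "a n = ip g (\<lambda>x. \<phi> x ^ n * e x)" for n
  have u: "(\<lambda>x. \<phi> x ^ n * e x) \<in> Hs" for n using contractive_power_mem \<phi>(1) e_mem by blast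
  have "summable (\<lambda>n. (cmod (a n))\<^sup>2)"
    by (rule summableI_nonneg_bounded[of _ "sq g"])
      (use Bessel[OF u orthonormal_powers[OF \<phi>(1-3)] g] in \<open>auto simp: a_def\<close>)
  from H2_coeffs_suminf[OF this] obtain f where f: "H2_coeffs f a" by blast
  define d where "d = (\<lambda>x. e x * f (\<phi> x) - g x)"
  have d: "d \<in> Hs" unfolding d_def by (rule diff_mem[OF H2_lift(1)[OF \<phi> f] g])
  have du: "ip (\<lambda>x. \<phi> x ^ n * e x) d = 0" for n
  proof -
    have "ip d (\<lambda>x. \<phi> x ^ n * e x) = 0"
      unfolding d_def using ip_diff_left[OF H2_lift(1)[OF \<phi> f] g u, of n] H2_lift(4)[OF \<phi> f, of n]
      by (simp add: a_def)
    then show ?thesis using ip_commute[OF d u, of n] by simp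
  qed
  have "d y = 0" for y
  proof -
    \<comment> \<open>By the Szego form, each kernel function is the lift of a geometric series and
      hence orthogonal to \<open>d\<close>.\<close>
    have "(\<lambda>x. K x y) = (\<lambda>x. e x * (cnj (e y) * szego (\<phi> x) (\<phi> y)))" by (simp add: K mult.assoc)
    then have "(\<lambda>k. 0) sums ip (\<lambda>x. K x y) d"
      using H2_lift(3)[OF \<phi> H2_coeffs_geometric[OF \<phi>(4)] d, of "cnj (e y)" y] by (simp add: du)
    then have "ip (\<lambda>x. K x y) d = 0" using sums_unique2[OF _ sums_zero] by blast
    then show ?thesis using ip_commute[OF kernel_mem d, of y] by (simp add: ip_kernel d)
  qed
  then have "\<forall>x. g x = e x * f (\<phi> x)" by (simp add: d_def)
  then show ?thesis using f unfolding H2_def by blast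
qed

text \<open>A function vanishing on the range lifts to 0, and the lift preserves the norm, so all
  coefficients vanish.\<close>

lemma uniqueness_range:
  assumes \<phi>: "contractive \<phi>" "isometric \<phi> e" "\<phi> x0 = 0" "\<And>x. cmod (\<phi> x) < 1"
  shows "uniqueness_set_H2 (range \<phi>)"
  unfolding uniqueness_set_H2_def
proof (intro conjI ballI impI)
  show "range \<phi> \<subseteq> ball 0 1" using \<phi>(4) by auto
  fix f z assume "f \<in> H2" and 0: "\<forall>z\<in>range \<phi>. f z = 0" and z: "z \<in> ball (0::complex) 1"
  then obtain a where f: "H2_coeffs f a" by (auto simp: H2_def)
  have "(\<lambda>x. e x * f (\<phi> x)) = (\<lambda>x. 0)" using 0 by simp
  then have "(\<Sum>n. (cmod (a n))\<^sup>2) = 0" using H2_lift(2)[OF \<phi> f] sq_zero by simp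
  then have "(cmod (a n))\<^sup>2 = 0" for n
    using suminf_eq_zero_iff[of "\<lambda>n. (cmod (a n))\<^sup>2"] conjunct1[OF f[unfolded H2_coeffs_def]] by simp
  then have "a n = 0" for n by simp
  then have "(\<lambda>n. 0) sums f z" using f z by (simp add: H2_coeffs_def)
  then show "f z = 0" using sums_unique2[OF _ sums_zero] by blast
qed

end

section \<open>The dichotomy and the regularity of the embedding\<close>

theorem theorem1p1:
  fixes Hs :: "('x \<Rightarrow> complex) set"
    and ip :: "('x \<Rightarrow> complex) \<Rightarrow> ('x \<Rightarrow> complex) \<Rightarrow> complex"
    and K :: "'x \<Rightarrow> 'x \<Rightarrow> complex"
  assumes rkhs: "is_rkhs Hs ip K"
    and irr: "irreducible_kernel K"
    and cnp: "complete_NP Hs ip K"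
    and hypo: "\<forall>\<phi>. multiplier Hs \<phi> \<longrightarrow> hyponormal Hs ip (\<lambda>f x. \<phi> x * f x)"
  shows
    "((\<exists>x0::'x. UNIV = {x0}) \<and> Hs = UNIV \<and>
      \<not> (\<exists>A j \<delta>. uniqueness_set_H2 A \<and> bij_betw j UNIV A \<and> (\<forall>x. \<delta> x \<noteq> 0) \<and>
            (\<forall>x y. K x y = \<delta> x * cnj (\<delta> y) * szego (j x) (j y))))
     \<or>
     (\<not> ((\<exists>x0::'x. UNIV = {x0}) \<and> Hs = UNIV) \<and>
      (\<exists>(A::complex set) (j::'x \<Rightarrow> complex) (\<delta>::'x \<Rightarrow> complex).
         uniqueness_set_H2 A \<and> bij_betw j UNIV A \<and> (\<forall>x. \<delta> x \<noteq> 0) \<and>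
         (\<forall>x y. K x y = \<delta> x * cnj (\<delta> y) * szego (j x) (j y)) \<and>
         (\<forall>f a. H2_coeffs f a \<longrightarrow>
             (\<lambda>x. \<delta> x * f (j x)) \<in> Hs \<and>
             (hnorm ip (\<lambda>x. \<delta> x * f (j x)))\<^sup>2 = (\<Sum>n. (cmod (a n))\<^sup>2)) \<and>
         (\<forall>g\<in>Hs. \<exists>f\<in>H2. \<forall>x. g x = \<delta> x * f (j x)) \<and>
         (\<forall>T::'x topology. topspace T = UNIV \<longrightarrow>
             (\<forall>y. continuous_map T euclidean (\<lambda>x. K x y)) \<longrightarrow>
             (\<forall>x. continuous_map T euclidean (\<lambda>y. K x y)) \<longrightarrow>
             continuous_map T euclidean j) \<and>
         (\<forall>\<iota>::'x \<Rightarrow> complex ^ 'n. inj \<iota> \<longrightarrow>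
             (\<forall>y. holo_on_set (\<lambda>w. K (inv \<iota> w) y) (range \<iota>)) \<longrightarrow>
             holo_on_set (\<lambda>w. j (inv \<iota> w)) (range \<iota>))))"
proof -
  interpret rkhs Hs ip K by unfold_locales (rule rkhs)
  show ?thesis
  proof (cases "\<exists>x0::'x. UNIV = {x0}")
    case True
    then obtain x0 :: 'x where X: "UNIV = {x0}" by blast
    \<comment> \<open>On a single point every function is a multiple of the kernel function, which
      is nonzero there.\<close>
    have mem: "f \<in> Hs" for f
    proof -
      have "f = (\<lambda>x. f x0 / K x0 x0 * K x x0)"
      proof
        fix x
        have "x = x0" using X by blast
        then show "f x = f x0 / K x0 x0 * K x x0" using irr by (simp add: irreducible_kernel_def)
      qed
      then show ?thesis using scale_mem[OF kernel_mem, of "f x0 / K x0 x0" x0] by simp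
    qed
    have none: "\<not> (uniqueness_set_H2 A \<and> bij_betw j UNIV A)" for A and j :: "'x \<Rightarrow> complex"
    proof
      assume "uniqueness_set_H2 A \<and> bij_betw j UNIV A"
      moreover from this have "A = {j x0}" unfolding bij_betw_def X by simp
      ultimately show False using singleton_not_uniqueness_set_H2 by blast
    qed
    show ?thesis
    proof (intro disjI1 conjI)
      show "\<exists>x0::'x. UNIV = {x0}" by (rule True)
      show "Hs = UNIV" using mem by blast
    qed (use none in blast)
  next
    case False
    \<comment> \<open>The element \<open>undefined\<close> serves as an arbitrary base point; as X
      is not a singleton, there is a second point.\<close>
    obtain y :: 'x where y: "y \<noteq> undefined"
    proof (rule ccontr)
      assume "\<not> thesis"
      then have "UNIV = {undefined :: 'x}" using that by auto
      then show False using False by blast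
    qed
    interpret hyponormal_pick Hs ip K undefined
      using hypo irr cnp by unfold_locales
    obtain \<phi> where \<phi>: "contractive \<phi>" "isometric \<phi> e" "\<phi> undefined = 0" and \<phi>y: "\<phi> y \<noteq> 0"
      and val: "\<And>x. \<phi> x * cnj (\<phi> y) = 1 - e x * cnj (e y) / K x y"
      and K: "\<And>x w. K x w = e x * cnj (e w) * szego (\<phi> x) (\<phi> w)"
      and lt: "\<And>x. cmod (\<phi> x) < 1"
      using kernel_form[OF y] by blast
    \<comment> \<open>Constants obtained by solving \<open>val\<close> for \<open>\<phi> x\<close>,
      with \<open>e\<close> written as a multiple of the kernel function at the base point.\<close>
    define c where "c = cnj (e y) / of_real (sqrt (kd undefined))"
    define d where "d = cnj (\<phi> y)"
    have d: "d \<noteq> 0" using \<phi>y by (simp add: d_def)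
    have j: "\<phi> x = (1 - c * K x undefined / K x y) / d" for x
      using val[of x] d by (simp add: c_def d_def e_def field_simps)
    \<comment> \<open>Equal values of \<open>\<phi>\<close> would make the two kernel functions
      proportional, against irreducibility.\<close>
    have "inj \<phi>"
    proof (rule injI, rule ccontr)
      fix v w assume eq: "\<phi> v = \<phi> w" and ne: "v \<noteq> w"
      have "(\<lambda>z. cnj (e w) * K z v + (- cnj (e v)) * K z w) = (\<lambda>z. 0)"
      proof
        fix z
        show "cnj (e w) * K z v + (- cnj (e v)) * K z w = 0"
          unfolding K[of z v] K[of z w] eq by (simp add: mult_ac)
      qed
      then show False using irr ne e_nonzero[of w] unfolding irreducible_kernel_def by fastforce
    qed
    then have bij: "bij_betw \<phi> UNIV (range \<phi>)" by (simp add: bij_betw_def)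
    have lift: "(\<lambda>x. e x * f (\<phi> x)) \<in> Hs \<and> (hnorm ip (\<lambda>x. e x * f (\<phi> x)))\<^sup>2 = (\<Sum>n. (cmod (a n))\<^sup>2)"
      if "H2_coeffs f a" for f a
      using H2_lift(1,2)[OF \<phi> lt that] hnorm_power2 by simp
    have surj: "\<exists>f\<in>H2. \<forall>x. g x = e x * f (\<phi> x)" if "g \<in> Hs" for g
      by (rule H2_lift_surj[OF \<phi> lt K that])
    have cont: "continuous_map T euclidean \<phi>"
      if "\<forall>y. continuous_map T euclidean (\<lambda>x. K x y)" for T
      using continuous_map_moebius[of T "\<lambda>x. K x undefined" "\<lambda>x. K x y" d c] that K_nonzero d
      by (simp flip: j)
    have holo: "holo_on_set (\<lambda>w. \<phi> (inv \<iota> w)) (range \<iota>)"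
      if "\<forall>y. holo_on_set (\<lambda>w. K (inv \<iota> w) y) (range \<iota>)" for \<iota> :: "'x \<Rightarrow> complex ^ 'n"
      using holo_on_set_moebius[of "\<lambda>w. K (inv \<iota> w) undefined" "range \<iota>" "\<lambda>w. K (inv \<iota> w) y" d c]
        that K_nonzero d
      by (simp flip: j)
    show ?thesis
    proof (rule disjI2, rule conjI, use False in blast, rule exI[of _ "range \<phi>"], rule exI[of _ \<phi>],
        rule exI[of _ e], intro conjI allI impI)
      show "uniqueness_set_H2 (range \<phi>)" by (rule uniqueness_range[OF \<phi> lt])
      show "\<forall>g\<in>Hs. \<exists>f\<in>H2. \<forall>x. g x = e x * f (\<phi> x)" using surj by blast
    qed (fact bij e_nonzero K | rule lift[THEN conjunct1] lift[THEN conjunct2] cont holo, assumption)+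
  qed
qed

end
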